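(* Consider any discrete memoryless two-user interference channel with generalized feedback (IC-GF) whose transition probability has the form $$p(y_1,y_2,y_{F_1},y_{F_2}|x_1,x_2)=p(y_1,y_2|x_1,x_2)\,p(y_{F_1}|x_2)\,p(y_{F_2}|x_1).$$ Its capacity region is contained in the region $\mathcal{DB}^{IC}_{UC}$, defined as the set (union over all admissible distributions) of all pairs $(R_1,R_2)$ of nonnegative reals for which there exist random variables $(T,X_1,X_2,Y_1,Y_2,Y_{F_1},Y_{F_2})$ with $$R_1\le I(X_1,X_2;Y_1),\qquad R_2\le I(X_1,X_2;Y_2),$$ $$R_1\le I(X_1;Y_1,Y_2,Y_{F_2}|X_2,T),\qquad R_2\le I(X_2;Y_1,Y_2,Y_{F_1}|X_1,T),$$ $$R_1+R_2\le I(X_1,X_2;Y_1,Y_2,Y_{F_1},Y_{F_2}|T),\qquad R_1+R_2\le I(X_1,X_2;Y_1,Y_2),$$ whose joint distribution has the form $$p(t,x_1,x_2,y_1,y_2,y_{F_1},y_{F_2})=p(t,x_1,x_2)\,p(y_1,y_2|x_1,x_2)\,p(y_{F_1}|x_2)\,p(y_{F_2}|x_1),$$ and which satisfy the dependence balance bound $$I(X_1;X_2|T)\le I(X_1;X_2|Y_{F_1},Y_{F_2},T),$$ where the alphabet $\mathcal T$ of $T$ is subject to the cardinality constraint $|\mathcal T|\le|\mathcal X_1||\mathcal X_2|+3$.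
   Context: A discrete memoryless IC-GF consists of finite input alphabets $\mathcal X_1,\mathcal X_2$, finite output alphabets $\mathcal Y_1,\mathcal Y_2$ at receivers 1 and 2, finite feedback alphabets $\mathcal Y_{F_1},\mathcal Y_{F_2}$ at transmitters 1 and 2, and a transition probability $p(y_1,y_2,y_{F_1},y_{F_2}|x_1,x_2)$, used memorylessly. An $(n,M_1,M_2,P_e^{(1)},P_e^{(2)})$ code consists of encoding functions $f_{ki}:\{1,\dots,M_k\}\times\mathcal Y_{F_k}^{i-1}\to\mathcal X_k$, $k=1,2$, $i=1,\dots,n$ (so $X_{ki}=f_{ki}(W_k,Y_{F_k}^{i-1})$), and decoders $g_k:\mathcal Y_k^n\to\{1,\dots,M_k\}$, $k=1,2$. The messages $W_1,W_2$ are independent and uniform on $\{1,\dots,M_1\}$, $\{1,\dots,M_2\}$, and $P_e^{(k)}=\Pr[\hat W_k\ne W_k]$ with $\hat W_k=g_k(Y_k^n)$. A pair $(R_1,R_2)$ of nonnegative reals is achievable if for all $\epsilon_1,\epsilon_2>0$ and all sufficiently large $n$ there is a code with $R_k\le\log(M_k)/n$ and $P_e^{(k)}\le\epsilon_k$ for $k=1,2$. The capacity region is the closure of the set of achievable pairs. *)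

theory Defs
  imports "HOL-Probability.Probability"
begin

text \<open>
  A discrete memoryless interference channel with generalized feedback is its transition
  kernel. Finite alphabets are types of class \<open>finite\<close>; an output letter is
  \<open>(y1, y2, z1, z2)\<close>, where \<open>zk\<close> is the feedback \<open>Y_F_k\<close> received by
  transmitter \<open>k\<close>.
\<close>

type_synonym ('x1, 'x2, 'y1, 'y2, 'f1, 'f2) icgf =
  "'x1 \<Rightarrow> 'x2 \<Rightarrow> ('y1 \<times> 'y2 \<times> 'f1 \<times> 'f2) pmf"

text \<open>
  An encoder \<open>f i w zs\<close> takes the time index \<open>i \<ge> 1\<close>, the message and the
  \<open>i - 1\<close> past feedback letters, oldest first.
\<close>

type_synonym ('z, 'x) encoder = "nat \<Rightarrow> nat \<Rightarrow> 'z list \<Rightarrow> 'x"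

primrec outputs ::
  "('x1, 'x2, 'y1, 'y2, 'f1, 'f2) icgf \<Rightarrow> ('f1, 'x1) encoder \<Rightarrow> ('f2, 'x2) encoder \<Rightarrow>
   nat \<Rightarrow> nat \<Rightarrow> nat \<Rightarrow> ('y1 \<times> 'y2 \<times> 'f1 \<times> 'f2) list pmf" where
  "outputs P f1 f2 w1 w2 0 = return_pmf []"
| "outputs P f1 f2 w1 w2 (Suc i) =
     bind_pmf (outputs P f1 f2 w1 w2 i) (\<lambda>h.
       map_pmf (\<lambda>s. h @ [s])
         (P (f1 (Suc i) w1 (map (\<lambda>(y1, y2, z1, z2). z1) h))
            (f2 (Suc i) w2 (map (\<lambda>(y1, y2, z1, z2). z2) h))))"

definition code_law ::
  "('x1, 'x2, 'y1, 'y2, 'f1, 'f2) icgf \<Rightarrow> ('f1, 'x1) encoder \<Rightarrow> ('f2, 'x2) encoder \<Rightarrow>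
   nat \<Rightarrow> nat \<Rightarrow> nat \<Rightarrow> ((nat \<times> nat) \<times> ('y1 \<times> 'y2 \<times> 'f1 \<times> 'f2) list) pmf" where
  "code_law P f1 f2 n M1 M2 =
     bind_pmf (pair_pmf (pmf_of_set {1..M1}) (pmf_of_set {1..M2})) (\<lambda>(w1, w2).
       map_pmf (\<lambda>h. ((w1, w2), h)) (outputs P f1 f2 w1 w2 n))"

definition is_code ::
  "('x1, 'x2, 'y1, 'y2, 'f1, 'f2) icgf \<Rightarrow> nat \<Rightarrow> nat \<Rightarrow> nat \<Rightarrow> real \<Rightarrow> real \<Rightarrow>
   ('f1, 'x1) encoder \<Rightarrow> ('f2, 'x2) encoder \<Rightarrow>
   ('y1 list \<Rightarrow> nat) \<Rightarrow> ('y2 list \<Rightarrow> nat) \<Rightarrow> bool" where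
  "is_code P n M1 M2 e1 e2 f1 f2 g1 g2 \<longleftrightarrow>
     M1 \<ge> 1 \<and> M2 \<ge> 1 \<and>
     (\<forall>ys. length ys = n \<longrightarrow> g1 ys \<in> {1..M1}) \<and>
     (\<forall>ys. length ys = n \<longrightarrow> g2 ys \<in> {1..M2}) \<and>
     e1 = measure_pmf.prob (code_law P f1 f2 n M1 M2)
            {((w1, w2), h). g1 (map (\<lambda>(y1, y2, z1, z2). y1) h) \<noteq> w1} \<and>
     e2 = measure_pmf.prob (code_law P f1 f2 n M1 M2)
            {((w1, w2), h). g2 (map (\<lambda>(y1, y2, z1, z2). y2) h) \<noteq> w2}"

text \<open>Rates and informations are in bits.\<close>

definition achievable ::
  "('x1, 'x2, 'y1, 'y2, 'f1, 'f2) icgf \<Rightarrow> real \<Rightarrow> real \<Rightarrow> bool" where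
  "achievable P R1 R2 \<longleftrightarrow> R1 \<ge> 0 \<and> R2 \<ge> 0 \<and>
     (\<forall>\<epsilon>1>0. \<forall>\<epsilon>2>0. \<forall>\<^sub>F n in sequentially.
        \<exists>M1 M2 e1 e2 f1 f2 g1 g2. is_code P n M1 M2 e1 e2 f1 f2 g1 g2 \<and>
          R1 \<le> log 2 (real M1) / real n \<and> R2 \<le> log 2 (real M2) / real n \<and>
          e1 \<le> \<epsilon>1 \<and> e2 \<le> \<epsilon>2)"

definition capacity_region ::
  "('x1, 'x2, 'y1, 'y2, 'f1, 'f2) icgf \<Rightarrow> (real \<times> real) set" where
  "capacity_region P = closure {(R1, R2). achievable P R1 R2}"

abbreviation MI :: "'w pmf \<Rightarrow> ('w \<Rightarrow> 'a) \<Rightarrow> ('w \<Rightarrow> 'b) \<Rightarrow> real" where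
  "MI J X Y \<equiv>
     prob_space.mutual_information (measure_pmf J) 2 (count_space UNIV) (count_space UNIV) X Y"

abbreviation CMI :: "'w pmf \<Rightarrow> ('w \<Rightarrow> 'a) \<Rightarrow> ('w \<Rightarrow> 'b) \<Rightarrow> ('w \<Rightarrow> 'c) \<Rightarrow> real" where
  "CMI J X Y Z \<equiv>
     prob_space.conditional_mutual_information (measure_pmf J) 2
       (count_space UNIV) (count_space UNIV) (count_space UNIV) X Y Z"

text \<open>
  Random variables \<open>(T, X1, X2, Y1, Y2, Y_F_1, Y_F_2)\<close> are given by their joint law on the
  product space, on which they are the coordinate projections. The letters of \<open>T\<close> are
  labelled by natural numbers; its alphabet is a finite set of labels.
\<close>

type_synonym ('x1, 'x2, 'y1, 'y2, 'f1, 'f2) outcome =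
  "nat \<times> 'x1 \<times> 'x2 \<times> 'y1 \<times> 'y2 \<times> 'f1 \<times> 'f2"

definition rvT :: "('x1, 'x2, 'y1, 'y2, 'f1, 'f2) outcome \<Rightarrow> nat" where
  "rvT = (\<lambda>(t, x1, x2, y1, y2, z1, z2). t)"
definition rvX1 :: "('x1, 'x2, 'y1, 'y2, 'f1, 'f2) outcome \<Rightarrow> 'x1" where
  "rvX1 = (\<lambda>(t, x1, x2, y1, y2, z1, z2). x1)"
definition rvX2 :: "('x1, 'x2, 'y1, 'y2, 'f1, 'f2) outcome \<Rightarrow> 'x2" where
  "rvX2 = (\<lambda>(t, x1, x2, y1, y2, z1, z2). x2)"
definition rvY1 :: "('x1, 'x2, 'y1, 'y2, 'f1, 'f2) outcome \<Rightarrow> 'y1" where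
  "rvY1 = (\<lambda>(t, x1, x2, y1, y2, z1, z2). y1)"
definition rvY2 :: "('x1, 'x2, 'y1, 'y2, 'f1, 'f2) outcome \<Rightarrow> 'y2" where
  "rvY2 = (\<lambda>(t, x1, x2, y1, y2, z1, z2). y2)"
definition rvF1 :: "('x1, 'x2, 'y1, 'y2, 'f1, 'f2) outcome \<Rightarrow> 'f1" where
  "rvF1 = (\<lambda>(t, x1, x2, y1, y2, z1, z2). z1)"
definition rvF2 :: "('x1, 'x2, 'y1, 'y2, 'f1, 'f2) outcome \<Rightarrow> 'f2" where
  "rvF2 = (\<lambda>(t, x1, x2, y1, y2, z1, z2). z2)"

definition DB_region ::
  "('x1 \<Rightarrow> 'x2 \<Rightarrow> ('y1 \<times> 'y2) pmf) \<Rightarrow> ('x2 \<Rightarrow> 'f1 pmf) \<Rightarrow> ('x1 \<Rightarrow> 'f2 pmf) \<Rightarrow>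
   (real \<times> real) set" where
  "DB_region Q F1 F2 = {(R1, R2). R1 \<ge> 0 \<and> R2 \<ge> 0 \<and>
     (\<exists>(\<T> :: nat set) (A :: (nat \<times> 'x1 \<times> 'x2) pmf)
        (J :: ('x1, 'x2, 'y1, 'y2, 'f1, 'f2) outcome pmf).
        finite \<T> \<and> card \<T> \<le> CARD('x1) * CARD('x2) + 3 \<and> rvT ` set_pmf J \<subseteq> \<T> \<and>
        (\<forall>t x1 x2 y1 y2 z1 z2. pmf J (t, x1, x2, y1, y2, z1, z2) =
           pmf A (t, x1, x2) * pmf (Q x1 x2) (y1, y2) * pmf (F1 x2) z1 * pmf (F2 x1) z2) \<and>
        R1 \<le> MI J (\<lambda>s. (rvX1 s, rvX2 s)) rvY1 \<and>
        R2 \<le> MI J (\<lambda>s. (rvX1 s, rvX2 s)) rvY2 \<and>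
        R1 \<le> CMI J rvX1 (\<lambda>s. (rvY1 s, rvY2 s, rvF2 s)) (\<lambda>s. (rvX2 s, rvT s)) \<and>
        R2 \<le> CMI J rvX2 (\<lambda>s. (rvY1 s, rvY2 s, rvF1 s)) (\<lambda>s. (rvX1 s, rvT s)) \<and>
        R1 + R2 \<le> CMI J (\<lambda>s. (rvX1 s, rvX2 s)) (\<lambda>s. (rvY1 s, rvY2 s, rvF1 s, rvF2 s)) rvT \<and>
        R1 + R2 \<le> MI J (\<lambda>s. (rvX1 s, rvX2 s)) (\<lambda>s. (rvY1 s, rvY2 s)) \<and>
        CMI J rvX1 rvX2 rvT \<le> CMI J rvX1 rvX2 (\<lambda>s. (rvF1 s, rvF2 s, rvT s)))}"

end

theory Submission
  imports Defs
begin

text \<open>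
  Fano's inequality and the telescoping of \<open>n\<close>-letter entropies bound the rates of a code by
  sums over the times \<open>i\<close> of informations conditioned on the past feedback of both users, and
  \<open>T\<close> consists of \<open>i\<close> and this feedback; given \<open>T\<close>, each input is a function of its own message. The
  dependence balance bound is the telescoped form of
  \<open>0 \<le> I(W1; W2 | feedback) - I(W1; W2)\<close>, where the last term vanishes.

  Every law of \<open>(T, X1, X2)\<close> is treated as a family of unnormalized slices
  \<open>b t = p(t, \<cdot>, \<cdot>)\<close>. An information conditioned on \<open>T\<close> is then a sum over \<open>t\<close> of a
  functional of \<open>b t\<close> that is homogeneous of degree one, so that time sharing over \<open>i\<close>
  just rescales the slices by \<open>1 / n\<close>, and the number of labels is reduced by a linear program
  in the weights of the slices: the \<open>|X1| |X2|\<close> coordinates of the marginal law of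
  \<open>(X1, X2)\<close> and three of the four conditional functionals are preserved, while the fourth
  is maximized. Boundary points are reached by compactness.
\<close>

section \<open>Entropy of finite weighted sets\<close>

text \<open>The number of labels \<open>(i, feedback)\<close> grows with the block length, so no
  limit can be taken among the codes directly. The reduction to
  \<open>CARD('x1) * CARD('x2) + 3\<close> labels therefore comes before the limit: after it, all
  slices lie in one compact set of fixed dimension, and a single limit absorbs the error
  probabilities, the additive constants of Fano's inequality and the closure in the capacity region.

  For user 1, telescoping yields the information that \<open>X1\<close> carries about all outputs
  given \<open>X2\<close> and \<open>T\<close>. The product form of the channel removes
  \<open>Y_F_1\<close> from it, because that letter is generated from \<open>X2\<close> alone; user
  2 is symmetric.

  The bounds conditioned on \<open>T\<close> are additive over the slices. Those without
  \<open>T\<close> are not: they rest on the concavity of mutual information in the input law, which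
  for a homogeneous functional is superadditivity over slices.

  In the dependence balance, messages are replaced by inputs. This is sound because the two
  entropies that can change enter with a positive sign, and the one given both messages stays the
  same in a memoryless channel.\<close>

definition marg :: "'s set \<Rightarrow> ('s \<Rightarrow> real) \<Rightarrow> ('s \<Rightarrow> 'v) \<Rightarrow> 'v \<Rightarrow> real" where
  "marg S a f v = (\<Sum>s | s \<in> S \<and> f s = v. a s)"

text \<open>An expectation over the points of \<open>S\<close> and not a sum over the values of
  \<open>f\<close>: the result depends only on the partition of \<open>S\<close> that
  \<open>f\<close> induces (\<open>Ent_fun_cong\<close>), so values can be regrouped and retyped
  freely. The total weight need not be 1.\<close>

definition Ent :: "'s set \<Rightarrow> ('s \<Rightarrow> real) \<Rightarrow> ('s \<Rightarrow> 'v) \<Rightarrow> real" where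
  "Ent S a f = (\<Sum>s\<in>S. a s * - log 2 (marg S a f (f s)))"

definition cond_Ent :: "'s set \<Rightarrow> ('s \<Rightarrow> real) \<Rightarrow> ('s \<Rightarrow> 'u) \<Rightarrow> ('s \<Rightarrow> 'v) \<Rightarrow> real" where
  "cond_Ent S a X Z = Ent S a (\<lambda>s. (X s, Z s)) - Ent S a Z"

definition cmi :: "'s set \<Rightarrow> ('s \<Rightarrow> real) \<Rightarrow> ('s \<Rightarrow> 'u) \<Rightarrow> ('s \<Rightarrow> 'v) \<Rightarrow> ('s \<Rightarrow> 'w) \<Rightarrow> real" where
  "cmi S a X Y Z = cond_Ent S a Y Z - cond_Ent S a Y (\<lambda>s. (X s, Z s))"

lemma marg_cong_fun:
  assumes "\<And>s'. s' \<in> S \<Longrightarrow> f s' = v \<longleftrightarrow> g s' = w"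
  shows "marg S a f v = marg S a g w"
  unfolding marg_def using assms by (intro sum.cong) auto

lemma Ent_fun_cong:
  assumes "\<And>s s'. s \<in> S \<Longrightarrow> s' \<in> S \<Longrightarrow> f s = f s' \<longleftrightarrow> g s = g s'"
  shows "Ent S a f = Ent S a g"
proof -
  have "marg S a f (f s) = marg S a g (g s)" if "s \<in> S" for s
    using assms that by (intro marg_cong_fun) metis
  then show ?thesis by (simp add: Ent_def)
qed

lemma marg_nonneg: "(\<And>s. s \<in> S \<Longrightarrow> 0 \<le> a s) \<Longrightarrow> 0 \<le> marg S a f v"
  unfolding marg_def by (intro sum_nonneg) auto

lemma marg_scale: "marg S (\<lambda>s. c * a s) f v = c * marg S a f v"
  unfolding marg_def by (simp add: sum_distrib_left)

lemma sum_marg: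
  assumes "finite S" "finite V" "f ` S \<subseteq> V"
  shows "(\<Sum>v\<in>V. marg S a f v * F v) = (\<Sum>s\<in>S. a s * F (f s))"
proof -
  have "marg S a f v * F v = (\<Sum>s | s \<in> S \<and> f s = v. a s * F (f s))" for v
    unfolding marg_def sum_distrib_right by (rule sum.cong) auto
  then have "(\<Sum>v\<in>V. marg S a f v * F v) = (\<Sum>v\<in>V. \<Sum>s | s \<in> S \<and> f s = v. a s * F (f s))"
    by (simp only:)
  also have "\<dots> = (\<Sum>s\<in>S. a s * F (f s))"
    by (rule sum.group[OF assms])
  finally show ?thesis .
qed

lemma Ent_eq_sum:
  assumes "finite S" "finite V" "f ` S \<subseteq> V"
  shows "Ent S a f = (\<Sum>v\<in>V. marg S a f v * - log 2 (marg S a f v))"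
  unfolding Ent_def using sum_marg[OF assms, of a "\<lambda>v. - log 2 (marg S a f v)"] by simp

text \<open>Entropy depends only on the image weights. Every change of sample space below goes
  through this fact: appending a letter, forgetting the messages, merging or splitting
  labels.\<close>

lemma Ent_push:
  assumes "finite S" "finite U" "g ` S \<subseteq> U" "\<And>u. u \<in> U \<Longrightarrow> b u = marg S a g u"
  shows "Ent U b f = Ent S a (\<lambda>s. f (g s))"
proof -
  have m: "marg U b f v = marg S a (\<lambda>s. f (g s)) v" for v
  proof -
    have "marg U b f v = (\<Sum>u\<in>U. if f u = v then b u else 0)"
      unfolding marg_def by (simp add: assms sum.If_cases Int_def)
    also have "\<dots> = (\<Sum>u\<in>U. marg S a g u * (if f u = v then 1 else 0))"
      using assms(4) by (intro sum.cong) auto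
    also have "\<dots> = (\<Sum>s\<in>S. a s * (if f (g s) = v then 1 else 0))"
      by (rule sum_marg) fact+
    also have "\<dots> = (\<Sum>s\<in>S. if f (g s) = v then a s else 0)"
      by (intro sum.cong) auto
    also have "\<dots> = marg S a (\<lambda>s. f (g s)) v"
      unfolding marg_def by (simp add: assms sum.If_cases Int_def)
    finally show ?thesis .
  qed
  have "Ent U b f = (\<Sum>u\<in>U. marg S a g u * - log 2 (marg S a (\<lambda>s. f (g s)) (f u)))"
    unfolding Ent_def m using assms(4) by (intro sum.cong) auto
  also have "\<dots> = Ent S a (\<lambda>s. f (g s))"
    unfolding Ent_def by (rule sum_marg) fact+
  finally show ?thesis .
qed

lemma cond_Ent_push:
  assumes "finite S" "finite U" "g ` S \<subseteq> U" "\<And>u. u \<in> U \<Longrightarrow> b u = marg S a g u"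
  shows "cond_Ent U b X Z = cond_Ent S a (\<lambda>s. X (g s)) (\<lambda>s. Z (g s))"
  unfolding cond_Ent_def by (simp add: Ent_push[OF assms])

lemma cmi_push:
  assumes "finite S" "finite U" "g ` S \<subseteq> U" "\<And>u. u \<in> U \<Longrightarrow> b u = marg S a g u"
  shows "cmi U b X Y Z = cmi S a (\<lambda>s. X (g s)) (\<lambda>s. Y (g s)) (\<lambda>s. Z (g s))"
  unfolding cmi_def by (simp add: cond_Ent_push[OF assms])

lemma Ent_const: "Ent S a (\<lambda>_. c) = sum a S * - log 2 (sum a S)"
  unfolding Ent_def marg_def by (simp add: sum_distrib_right[symmetric] sum_negf)

text \<open>With the label as part of the value, no marginal mixes two labels and the double sum
  separates. No entropy of the label appears as a separate term, because the slices are not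
  normalized.\<close>

lemma Ent_split:
  assumes "finite L" "finite B"
  shows "Ent (L \<times> B) a (\<lambda>(l, s). (f s, l)) = (\<Sum>l\<in>L. Ent B (\<lambda>s. a (l, s)) f)"
proof -
  have "marg (L \<times> B) a (\<lambda>(l, s). (f s, l)) (v, l) = marg B (\<lambda>s. a (l, s)) f v" if "l \<in> L" for v l
    unfolding marg_def using that
    by (intro sum.reindex_bij_witness[of _ "Pair l" snd]) auto
  then show ?thesis
    unfolding Ent_def sum.cartesian_product by (intro sum.cong) auto
qed

text \<open>The correction depends on the total mass alone and not on \<open>f\<close>, so it
  cancels in a difference of two entropies. This makes \<open>cmi\<close> homogeneous of degree
  one.\<close>

lemma Ent_scale:
  assumes "finite S" "\<And>s. s \<in> S \<Longrightarrow> 0 \<le> a s" "0 \<le> c"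
  shows "Ent S (\<lambda>s. c * a s) f = c * Ent S a f + sum a S * (c * - log 2 c)"
proof -
  have "c * a s * - log 2 (c * marg S a f (f s)) =
    c * (a s * - log 2 (marg S a f (f s))) + a s * (c * - log 2 c)" if s: "s \<in> S" for s
  proof (cases "c = 0 \<or> a s = 0")
    case False
    have "a s \<le> marg S a f (f s)"
      unfolding marg_def using assms s by (intro member_le_sum) auto
    moreover have "0 < a s" "0 < c" using False assms s by (auto simp: less_le)
    ultimately show ?thesis by (simp add: log_mult algebra_simps)
  qed auto
  then show ?thesis
    unfolding Ent_def marg_scale sum_distrib_left sum_distrib_right sum.distrib[symmetric]
    by (intro sum.cong refl)
qed

lemma cmi_scale:
  assumes "finite S" "\<And>s. s \<in> S \<Longrightarrow> 0 \<le> a s" "0 \<le> c"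
  shows "cmi S (\<lambda>s. c * a s) X Y Z = c * cmi S a X Y Z"
  unfolding cmi_def cond_Ent_def by (simp add: Ent_scale assms right_diff_distrib)

lemma cmi_split:
  assumes "finite L" "finite B"
  shows "cmi (L \<times> B) a (\<lambda>(l, s). X s) (\<lambda>(l, s). Y s) (\<lambda>(l, s). (Z s, l)) =
    (\<Sum>l\<in>L. cmi B (\<lambda>s. a (l, s)) X Y Z)"
proof -
  note sp = Ent_split[OF assms, of a, symmetric]
  show ?thesis
    unfolding cmi_def cond_Ent_def sum_subtractf sp
    by (intro arg_cong2[of _ _ _ _ "(-)"] Ent_fun_cong refl) auto
qed

subsection \<open>Gibbs' inequality and its consequences\<close>

locale weighted_set =
  fixes S :: "'s set" and a :: "'s \<Rightarrow> real"
  assumes finite_S: "finite S" and nonneg: "\<And>s. s \<in> S \<Longrightarrow> 0 \<le> a s"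
begin

lemma marg_pos: "s \<in> S \<Longrightarrow> 0 < a s \<Longrightarrow> 0 < marg S a f (f s)"
  unfolding marg_def using finite_S nonneg
  by (intro sum_pos2[where i = s]) auto

text \<open>Apply \<open>ln r \<le> r - 1\<close> to the ratio \<open>r\<close> of the guessed joint
  weight to the true one; its weighted sum is at most the total mass. All entropy inequalities below
  come from a choice of the guess \<open>q\<close>, which may be a subprobability.\<close>

lemma gibbs:
  assumes q0: "\<And>x z. x \<in> X ` S \<Longrightarrow> z \<in> Z ` S \<Longrightarrow> 0 \<le> q x z"
    and q1: "\<And>z. z \<in> Z ` S \<Longrightarrow> (\<Sum>x\<in>X ` S. q x z) \<le> 1"
    and qp: "\<And>s. s \<in> S \<Longrightarrow> 0 < a s \<Longrightarrow> 0 < q (X s) (Z s)"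
  shows "cond_Ent S a X Z \<le> (\<Sum>s\<in>S. a s * - log 2 (q (X s) (Z s)))"
proof -
  define mZ where "mZ = marg S a Z"
  define mXZ where "mXZ = marg S a (\<lambda>s. (X s, Z s))"
  define r where "r x z = q x z * mZ z / mXZ (x, z)" for x z
  have mZ0: "0 \<le> mZ z" for z unfolding mZ_def by (intro marg_nonneg nonneg)
  have mXZ0: "0 \<le> mXZ z" for z unfolding mXZ_def by (intro marg_nonneg nonneg)
  have fin: "finite (X ` S \<times> Z ` S)" using finite_S by auto
  have "a s * (- log 2 (mXZ (X s, Z s)) + log 2 (mZ (Z s)) + log 2 (q (X s) (Z s)))
      \<le> a s * ((r (X s) (Z s) - 1) / ln 2)" if s: "s \<in> S" for s
  proof (cases "a s = 0")
    case False
    then have as: "0 < a s" using nonneg[OF s] by simp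
    have p: "0 < mXZ (X s, Z s)" "0 < mZ (Z s)" "0 < q (X s) (Z s)"
      unfolding mXZ_def mZ_def using marg_pos[OF s as, of "\<lambda>s. (X s, Z s)"]
      using marg_pos[OF s as, of Z] qp[OF s as] by auto
    then have r: "0 < r (X s) (Z s)" by (simp add: r_def)
    have "- log 2 (mXZ (X s, Z s)) + log 2 (mZ (Z s)) + log 2 (q (X s) (Z s)) = log 2 (r (X s) (Z s))"
      unfolding r_def using p by (simp add: log_mult log_divide)
    also have "\<dots> \<le> (r (X s) (Z s) - 1) / ln 2"
      unfolding log_def using ln_le_minus_one[OF r] by (intro divide_right_mono) auto
    finally show ?thesis using as by (intro mult_left_mono) auto
  qed simp
  then have "(\<Sum>s\<in>S. a s * (- log 2 (mXZ (X s, Z s)) + log 2 (mZ (Z s)) + log 2 (q (X s) (Z s))))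
      \<le> (\<Sum>s\<in>S. a s * ((r (X s) (Z s) - 1) / ln 2))"
    by (intro sum_mono) auto
  also have "\<dots> = ((\<Sum>s\<in>S. a s * r (X s) (Z s)) - sum a S) / ln 2"
    by (simp add: sum_divide_distrib sum_subtractf diff_divide_distrib algebra_simps)
  also have "\<dots> \<le> 0"
  proof -
    have "(\<Sum>s\<in>S. a s * r (X s) (Z s)) = (\<Sum>(x, z)\<in>X ` S \<times> Z ` S. mXZ (x, z) * r x z)"
      unfolding mXZ_def using sum_marg[OF finite_S fin, of "\<lambda>s. (X s, Z s)" a "\<lambda>(x, z). r x z"]
      by (simp add: split_beta image_subset_iff)
    also have "\<dots> \<le> (\<Sum>(x, z)\<in>X ` S \<times> Z ` S. q x z * mZ z)"
      using q0 mZ0 mXZ0 by (intro sum_mono) (auto simp: r_def)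
    also have "\<dots> = (\<Sum>z\<in>Z ` S. (\<Sum>x\<in>X ` S. q x z) * mZ z)"
      by (simp add: sum.cartesian_product[symmetric] sum_distrib_right) (rule sum.swap)
    also have "\<dots> \<le> (\<Sum>z\<in>Z ` S. mZ z * 1)"
      using q1 mZ0 by (intro sum_mono) (simp add: mult_left_le_one_le mult.commute mult_left_le)
    also have "\<dots> = sum a S"
      unfolding mZ_def using finite_S by (subst sum_marg) auto
    finally show ?thesis by (simp add: divide_le_0_iff)
  qed
  finally show ?thesis
    unfolding cond_Ent_def Ent_def mZ_def mXZ_def
    by (simp add: algebra_simps sum.distrib sum_subtractf sum_negf)
qed

text \<open>Gibbs' inequality with the conditional law of \<open>X\<close> given \<open>Z'\<close>
  as the guess. It is a function of \<open>Z\<close> because \<open>Z\<close> determines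
  \<open>Z'\<close>, and its cross-entropy is exactly the right-hand side.\<close>

lemma cond_Ent_mono:
  assumes "\<And>s s'. s \<in> S \<Longrightarrow> s' \<in> S \<Longrightarrow> Z s = Z s' \<Longrightarrow> Z' s = Z' s'"
  shows "cond_Ent S a X Z \<le> cond_Ent S a X Z'"
proof -
  define h where "h z = Z' (SOME s. s \<in> S \<and> Z s = z)" for z
  have h: "h (Z s) = Z' s" if "s \<in> S" for s
    unfolding h_def using assms that by (rule_tac someI2[of _ s]) blast+
  define q where "q x z = marg S a (\<lambda>s. (X s, Z' s)) (x, h z) / marg S a Z' (h z)" for x z
  have "cond_Ent S a X Z \<le> (\<Sum>s\<in>S. a s * - log 2 (q (X s) (Z s)))"
  proof (rule gibbs)
    show "0 \<le> q x z" for x z unfolding q_def by (intro divide_nonneg_nonneg marg_nonneg nonneg)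
    have "(\<Sum>x\<in>X ` S. marg S a (\<lambda>s. (X s, Z' s)) (x, z)) = marg S a Z' z" for z
    proof -
      have "(\<Sum>x\<in>X ` S. marg S a (\<lambda>s. (X s, Z' s)) (x, z)) =
        (\<Sum>x\<in>X ` S. \<Sum>s | s \<in> {s \<in> S. Z' s = z} \<and> X s = x. a s)"
        unfolding marg_def by (intro sum.cong) auto
      also have "\<dots> = (\<Sum>s | s \<in> S \<and> Z' s = z. a s)"
        using finite_S by (intro sum.group) auto
      finally show ?thesis unfolding marg_def .
    qed
    \<comment> \<open>The sum is a quotient of equal numbers: 1, or 0 where \<open>Z'\<close> has no
      mass and the division is by zero.\<close>
    then show "(\<Sum>x\<in>X ` S. q x z) \<le> 1" for z
      unfolding q_def sum_divide_distrib[symmetric] by simp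
    show "0 < q (X s) (Z s)" if "s \<in> S" "0 < a s" for s
      unfolding q_def h[OF that(1)] using marg_pos[OF that, of "\<lambda>s. (X s, Z' s)"] marg_pos[OF that, of Z']
      by auto
  qed
  also have "\<dots> = cond_Ent S a X Z'"
  proof -
    have "a s * - log 2 (q (X s) (Z s)) = a s * - log 2 (marg S a (\<lambda>s. (X s, Z' s)) (X s, Z' s))
      - a s * - log 2 (marg S a Z' (Z' s))" if s: "s \<in> S" for s
    proof (cases "a s = 0")
      case False
      then have as: "0 < a s" using nonneg[OF s] by simp
      show ?thesis unfolding q_def h[OF s]
        using marg_pos[OF s as, of "\<lambda>s. (X s, Z' s)"] marg_pos[OF s as, of Z']
        by (simp add: log_divide algebra_simps)
    qed simp
    then show ?thesis
      unfolding cond_Ent_def Ent_def sum_subtractf[symmetric] by (intro sum.cong refl)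
  qed
  finally show ?thesis .
qed

lemma cond_Ent_cong:
  assumes "\<And>s s'. s \<in> S \<Longrightarrow> s' \<in> S \<Longrightarrow> Z s = Z s' \<longleftrightarrow> Z' s = Z' s'"
  shows "cond_Ent S a X Z = cond_Ent S a X Z'"
  using assms by (intro antisym cond_Ent_mono) auto

lemma cmi_nonneg: "0 \<le> cmi S a X Y Z"
  unfolding cmi_def using cond_Ent_mono[of "\<lambda>s. (X s, Z s)" Z Y] by simp

lemma cond_Ent_le_log_card:
  assumes "X ` S \<subseteq> V" "finite V" "sum a S = 1"
  shows "cond_Ent S a X Z \<le> log 2 (card V)"
proof -
  have ne: "S \<noteq> {}" using assms by auto
  then have V: "0 < card V" using assms by (auto simp: card_gt_0_iff)
  have "card (X ` S) \<le> card V" using assms by (intro card_mono)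
  then have "cond_Ent S a X Z \<le> (\<Sum>s\<in>S. a s * - log 2 (1 / card V))"
    using V by (intro gibbs[where q = "\<lambda>_ _. 1 / card V"]) auto
  also have "\<dots> = sum a S * log 2 (card V)"
    using V by (simp add: sum_distrib_right log_divide)
  also have "\<dots> = log 2 (card V)"
    using assms by simp
  finally show ?thesis .
qed

text \<open>Gibbs' inequality against the guess that puts mass \<open>1/2\<close> on the decoded message and
  spreads the other half uniformly.\<close>

lemma fano:
  fixes M :: nat
  assumes "X ` S \<subseteq> V" "finite V" "card V = M" "sum a S = 1"
  shows "cond_Ent S a X Z \<le> 1 + (\<Sum>s | s \<in> S \<and> g (Z s) \<noteq> X s. a s) * log 2 M"
proof -
  have ne: "S \<noteq> {}" using assms by auto
  then have M: "0 < M" using assms by (auto simp: card_gt_0_iff)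
  define q where "q x z = (if g z = x then 1 / 2 else 1 / (2 * real M))" for x z
  have "cond_Ent S a X Z \<le> (\<Sum>s\<in>S. a s * - log 2 (q (X s) (Z s)))"
  proof (rule gibbs)
    show "0 \<le> q x z" for x z by (simp add: q_def)
    show "0 < q (X s) (Z s)" for s using M by (simp add: q_def)
    fix z
    have "(\<Sum>x\<in>X ` S. q x z) \<le> (\<Sum>x\<in>V. q x z)"
      using assms by (intro sum_mono2) (auto simp: q_def)
    also have "\<dots> \<le> (\<Sum>x\<in>V. (if g z = x then 1 / 2 else 0) + 1 / (2 * real M))"
      by (intro sum_mono) (auto simp: q_def)
    also have "\<dots> \<le> 1"
      using assms M by (simp add: sum.distrib)
    finally show "(\<Sum>x\<in>X ` S. q x z) \<le> 1" .
  qed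
  \<comment> \<open>A correct guess costs \<open>log 2 2 = 1\<close>, a wrong one
    \<open>log 2 (2 * M) = 1 + log 2 M\<close>. The constant 1 stands in for the binary entropy of
    the error.\<close>
  also have "\<dots> = (\<Sum>s\<in>S. a s + (if g (Z s) \<noteq> X s then a s * log 2 M else 0))"
    using M by (intro sum.cong) (auto simp: q_def log_divide log_mult algebra_simps)
  also have "\<dots> = 1 + (\<Sum>s | s \<in> S \<and> g (Z s) \<noteq> X s. a s) * log 2 M"
    using assms finite_S by (simp add: sum.distrib sum.If_cases Int_def sum_distrib_right)
  finally show ?thesis .
qed

end

subsection \<open>Transition kernels\<close>

context weighted_set
begin

lemma weighted_set_kernel:
  fixes k :: "'s \<Rightarrow> 'b \<Rightarrow> real"
  assumes "finite B" "\<And>s u. s \<in> S \<Longrightarrow> u \<in> B \<Longrightarrow> 0 \<le> k s u"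
  shows "weighted_set (S \<times> B) (\<lambda>(s, u). a s * k s u)"
  using assms finite_S nonneg by unfold_locales auto

lemma marg_kernel:
  fixes k :: "'s \<Rightarrow> 'b \<Rightarrow> real"
  assumes "s \<in> S" "\<And>s'. s' \<in> S \<Longrightarrow> r s' = r s \<Longrightarrow> k s' = k s"
  shows "marg (S \<times> B) (\<lambda>(s, u). a s * k s u) (\<lambda>(s, u). (g u, r s)) (v, r s) =
    marg S a r (r s) * marg B (k s) g v"
proof -
  have "{p \<in> S \<times> B. (case p of (s, u) \<Rightarrow> (g u, r s)) = (v, r s)} =
      {s' \<in> S. r s' = r s} \<times> {u \<in> B. g u = v}" by auto
  then have "marg (S \<times> B) (\<lambda>(s, u). a s * k s u) (\<lambda>(s, u). (g u, r s)) (v, r s) =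
      (\<Sum>s' | s' \<in> S \<and> r s' = r s. \<Sum>u | u \<in> B \<and> g u = v. a s' * k s' u)"
    unfolding marg_def by (simp only: sum.cartesian_product)
  also have "\<dots> = (\<Sum>s' | s' \<in> S \<and> r s' = r s. \<Sum>u | u \<in> B \<and> g u = v. a s' * k s u)"
  proof (intro sum.cong refl)
    fix s' u assume "s' \<in> {s' \<in> S. r s' = r s}"
    then have "k s' = k s" by (intro assms(2)) auto
    then show "a s' * k s' u = a s' * k s u" by (rule arg_cong)
  qed
  also have "\<dots> = marg S a r (r s) * marg B (k s) g v"
    unfolding marg_def sum_product ..
  finally show ?thesis .
qed

lemma marg_kernel_fst:
  assumes "s \<in> S" "\<And>s. s \<in> S \<Longrightarrow> (\<Sum>u\<in>B. k s u) = 1"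
  shows "marg (S \<times> B) (\<lambda>(s, u). a s * k s u) (\<lambda>(s, u). f s) v = marg S a f v"
proof -
  have "{p \<in> S \<times> B. (case p of (s, u) \<Rightarrow> f s) = v} = {s \<in> S. f s = v} \<times> B" by auto
  then have "marg (S \<times> B) (\<lambda>(s, u). a s * k s u) (\<lambda>(s, u). f s) v =
      (\<Sum>s | s \<in> S \<and> f s = v. \<Sum>u\<in>B. a s * k s u)"
    unfolding marg_def by (simp only: sum.cartesian_product)
  also have "\<dots> = (\<Sum>s | s \<in> S \<and> f s = v. a s)"
    using assms by (intro sum.cong) (auto simp: sum_distrib_left[symmetric])
  finally show ?thesis unfolding marg_def .
qed

lemma Ent_kernel_fst:
  assumes "finite B" "\<And>s. s \<in> S \<Longrightarrow> (\<Sum>u\<in>B. k s u) = 1"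
  shows "Ent (S \<times> B) (\<lambda>(s, u). a s * k s u) (\<lambda>(s, u). f s) = Ent S a f"
proof -
  have "Ent (S \<times> B) (\<lambda>(s, u). a s * k s u) (\<lambda>(s, u). f s) =
      (\<Sum>s\<in>S. \<Sum>u\<in>B. a s * k s u * - log 2 (marg S a f (f s)))"
    unfolding Ent_def sum.cartesian_product
    by (intro sum.cong) (auto simp: marg_kernel_fst[OF _ assms(2)])
  also have "\<dots> = (\<Sum>s\<in>S. (\<Sum>u\<in>B. k s u) * (a s * - log 2 (marg S a f (f s))))"
    unfolding sum_distrib_right by (intro sum.cong) auto
  also have "\<dots> = Ent S a f"
    unfolding Ent_def using assms by (intro sum.cong) auto
  finally show ?thesis .
qed

text \<open>Once \<open>r\<close> is known, so is the row \<open>k s\<close>, and the entropy left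
  in the letter is the mean entropy of the rows. The right-hand side does not mention
  \<open>r\<close>; memorylessness is used below as equality between the left-hand sides for two
  such \<open>r\<close>.\<close>

lemma cond_Ent_kernel:
  fixes k :: "'s \<Rightarrow> 'b \<Rightarrow> real"
  assumes B: "finite B" and k0: "\<And>s u. s \<in> S \<Longrightarrow> u \<in> B \<Longrightarrow> 0 \<le> k s u"
    and k1: "\<And>s. s \<in> S \<Longrightarrow> (\<Sum>u\<in>B. k s u) = 1"
    and r: "\<And>s s'. s \<in> S \<Longrightarrow> s' \<in> S \<Longrightarrow> r s = r s' \<Longrightarrow> k s = k s'"
  shows "cond_Ent (S \<times> B) (\<lambda>(s, u). a s * k s u) (\<lambda>(s, u). g u) (\<lambda>(s, u). r s) =
    (\<Sum>s\<in>S. a s * Ent B (k s) g)"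
proof -
  let ?w = "\<lambda>(s, u). a s * k s u"
  interpret K: weighted_set "S \<times> B" ?w
    by (rule weighted_set_kernel[OF B k0])
  have eq: "(\<lambda>p. (case p of (s, u) \<Rightarrow> g u, case p of (s, u) \<Rightarrow> r s)) = (\<lambda>(s, u). (g u, r s))"
    by auto
  have "?w p * - log 2 (marg (S \<times> B) ?w (\<lambda>p. (case p of (s, u) \<Rightarrow> g u, case p of (s, u) \<Rightarrow> r s))
        (case p of (s, u) \<Rightarrow> g u, case p of (s, u) \<Rightarrow> r s))
      - ?w p * - log 2 (marg (S \<times> B) ?w (\<lambda>(s, u). r s) (case p of (s, u) \<Rightarrow> r s))
      = (case p of (s, u) \<Rightarrow> a s * (k s u * - log 2 (marg B (k s) g (g u))))"
    if p: "p \<in> S \<times> B" for p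
  proof (cases "?w p = 0")
    case False
    obtain s u where su: "p = (s, u)" "s \<in> S" "u \<in> B" using p by auto
    interpret Ks: weighted_set B "k s"
      using B k0[OF su(2)] by unfold_locales auto
    have pos: "0 < a s" "0 < k s u"
      using False su nonneg[of s] k0[of s u] by (auto simp: less_le)
    have m: "marg (S \<times> B) ?w (\<lambda>(s, u). (g u, r s)) (g u, r s) = marg S a r (r s) * marg B (k s) g (g u)"
      by (rule marg_kernel[OF su(2)], rule r) (use su in auto)
    have m': "marg (S \<times> B) ?w (\<lambda>(s, u). r s) (r s) = marg S a r (r s)"
      by (rule marg_kernel_fst[OF su(2) k1])
    show ?thesis
      using marg_pos[OF su(2) pos(1), of r] Ks.marg_pos[OF su(3) pos(2), of g]
      unfolding eq su(1) by (simp add: m m' log_mult algebra_simps)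
  qed (auto split: prod.splits)
  then have "cond_Ent (S \<times> B) ?w (\<lambda>(s, u). g u) (\<lambda>(s, u). r s) =
    (\<Sum>p\<in>S \<times> B. case p of (s, u) \<Rightarrow> a s * (k s u * - log 2 (marg B (k s) g (g u))))"
    unfolding cond_Ent_def Ent_def sum_subtractf[symmetric] by (intro sum.cong refl)
  then show ?thesis
    unfolding Ent_def sum_distrib_left sum.cartesian_product by (simp only:)
qed

text \<open>The letter \<open>u\<close> is drawn from a row fixed by \<open>Z\<close>, so its
  entropy given \<open>Y\<close> and \<open>Z\<close> does not change when \<open>X\<close> joins
  the condition. By the chain rule its contributions \<open>c1\<close> and \<open>c2\<close>
  cancel.\<close>

lemma cmi_drop_kernel:
  fixes k :: "'s \<Rightarrow> 'b \<Rightarrow> real"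
  assumes B: "finite B" and k0: "\<And>s u. s \<in> S \<Longrightarrow> u \<in> B \<Longrightarrow> 0 \<le> k s u"
    and k1: "\<And>s. s \<in> S \<Longrightarrow> (\<Sum>u\<in>B. k s u) = 1"
    and Z: "\<And>s s'. s \<in> S \<Longrightarrow> s' \<in> S \<Longrightarrow> Z s = Z s' \<Longrightarrow> k s = k s'"
  shows "cmi (S \<times> B) (\<lambda>(s, u). a s * k s u) (\<lambda>(s, u). X s) (\<lambda>(s, u). (Y s, u)) (\<lambda>(s, u). Z s) =
    cmi (S \<times> B) (\<lambda>(s, u). a s * k s u) (\<lambda>(s, u). X s) (\<lambda>(s, u). Y s) (\<lambda>(s, u). Z s)"
proof -
  let ?w = "\<lambda>(s, u). a s * k s u"
  let ?E = "\<lambda>f. Ent (S \<times> B) ?w f"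
  have c1: "cond_Ent (S \<times> B) ?w (\<lambda>(s, u). u) (\<lambda>(s, u). (Y s, Z s)) = (\<Sum>s\<in>S. a s * Ent B (k s) (\<lambda>u. u))"
    by (rule cond_Ent_kernel[where g = "\<lambda>u. u", OF B k0 k1], simp_all) (rule Z, auto)
  have c2: "cond_Ent (S \<times> B) ?w (\<lambda>(s, u). u) (\<lambda>(s, u). (Y s, X s, Z s)) = (\<Sum>s\<in>S. a s * Ent B (k s) (\<lambda>u. u))"
    by (rule cond_Ent_kernel[where g = "\<lambda>u. u", OF B k0 k1], simp_all) (rule Z, auto)
  have "?E (\<lambda>p. (case p of (s, u) \<Rightarrow> (Y s, u), case p of (s, u) \<Rightarrow> Z s)) =
      ?E (\<lambda>p. (case p of (s, u) \<Rightarrow> u, case p of (s, u) \<Rightarrow> (Y s, Z s)))"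
    "?E (\<lambda>p. (case p of (s, u) \<Rightarrow> (Y s, u), case p of (s, u) \<Rightarrow> X s, case p of (s, u) \<Rightarrow> Z s)) =
      ?E (\<lambda>p. (case p of (s, u) \<Rightarrow> u, case p of (s, u) \<Rightarrow> (Y s, X s, Z s)))"
    "?E (\<lambda>p. (case p of (s, u) \<Rightarrow> Y s, case p of (s, u) \<Rightarrow> Z s)) = ?E (\<lambda>(s, u). (Y s, Z s))"
    "?E (\<lambda>p. (case p of (s, u) \<Rightarrow> Y s, case p of (s, u) \<Rightarrow> X s, case p of (s, u) \<Rightarrow> Z s)) =
      ?E (\<lambda>(s, u). (Y s, X s, Z s))"
    by (intro Ent_fun_cong; force)+
  then show ?thesis
    using c1 c2 unfolding cmi_def cond_Ent_def by linarith
qed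

end

text \<open>Both sides rearrange the same eight entropies. The right-hand side speaks only of the
  entropy of \<open>F\<close>, the new feedback letters, and there messages can be exchanged for
  inputs term by term.\<close>

lemma cmi_diff:
  "cmi S a X Y (\<lambda>s. (F s, Z s)) - cmi S a X Y Z =
    cond_Ent S a F (\<lambda>s. (X s, Z s)) + cond_Ent S a F (\<lambda>s. (Y s, Z s))
    - cond_Ent S a F Z - cond_Ent S a F (\<lambda>s. (X s, Y s, Z s))"
proof -
  let ?E = "\<lambda>f. Ent S a f"
  have "?E (\<lambda>s. (Y s, F s, Z s)) = ?E (\<lambda>s. (F s, Y s, Z s))"
    "?E (\<lambda>s. (X s, F s, Z s)) = ?E (\<lambda>s. (F s, X s, Z s))"
    "?E (\<lambda>s. (Y s, X s, F s, Z s)) = ?E (\<lambda>s. (F s, X s, Y s, Z s))"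
    "?E (\<lambda>s. (Y s, X s, Z s)) = ?E (\<lambda>s. (X s, Y s, Z s))"
    by (intro Ent_fun_cong; force)+
  then show ?thesis unfolding cmi_def cond_Ent_def by simp
qed

section \<open>Block codes over a channel with feedback\<close>

text \<open>A history splits into its last letter and the rest in only one way, so a single term of
  the mixture contributes.\<close>

lemma pmf_outputs_Suc:
  fixes P :: "('x1, 'x2, 'y1, 'y2, 'f1, 'f2) icgf"
  shows "pmf (outputs P f1 f2 w1 w2 (Suc i)) (h @ [u]) = pmf (outputs P f1 f2 w1 w2 i) h *
    pmf (P (f1 (Suc i) w1 (map (\<lambda>(y1, y2, z1, z2). z1) h))
           (f2 (Suc i) w2 (map (\<lambda>(y1, y2, z1, z2). z2) h))) u"
proof -
  define K where "K h = P (f1 (Suc i) w1 (map (\<lambda>(y1, y2, z1, z2). z1) h))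
           (f2 (Suc i) w2 (map (\<lambda>(y1, y2, z1, z2). z2) h))"
    for h :: "('y1 \<times> 'y2 \<times> 'f1 \<times> 'f2) list"
  have inj: "pmf (map_pmf (\<lambda>s. h @ [s]) (K h)) (h @ [u]) = pmf (K h) u"
    by (rule pmf_map_inj'[of "\<lambda>s. h @ [s]"]) (auto simp: inj_def)
  have "pmf (outputs P f1 f2 w1 w2 (Suc i)) (h @ [u]) =
      (\<Sum>h'\<in>{h}. pmf (map_pmf (\<lambda>s. h' @ [s]) (K h')) (h @ [u]) * pmf (outputs P f1 f2 w1 w2 i) h')"
    unfolding outputs.simps pmf_bind K_def[symmetric]
    by (rule integral_measure_pmf_real) (auto simp: set_pmf_eq[symmetric] pmf_eq_0_set_pmf)
  also have "\<dots> = pmf (outputs P f1 f2 w1 w2 i) h * pmf (K h) u"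
    by (simp add: inj)
  finally show ?thesis unfolding K_def .
qed

lemma length_outputs: "h \<in> set_pmf (outputs P f1 f2 w1 w2 i) \<Longrightarrow> length h = i"
  by (induction i arbitrary: h) (auto simp: set_bind_pmf)

lemma pmf_code_law:
  fixes P :: "('x1, 'x2, 'y1, 'y2, 'f1, 'f2) icgf"
  assumes "w1 \<in> {1..M1}" "w2 \<in> {1..M2}"
  shows "pmf (code_law P f1 f2 i M1 M2) ((w1, w2), h) =
    pmf (outputs P f1 f2 w1 w2 i) h / (real M1 * real M2)"
proof -
  have inj: "pmf (map_pmf (\<lambda>h. ((w1, w2), h)) K) ((w1, w2), h) = pmf K h" for K :: "('y1 \<times> 'y2 \<times> 'f1 \<times> 'f2) list pmf"
    by (rule pmf_map_inj') (auto simp: inj_def)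
  have "pmf (code_law P f1 f2 i M1 M2) ((w1, w2), h) =
    (\<Sum>w\<in>{(w1, w2)}. pmf (case w of (w1, w2) \<Rightarrow> map_pmf (\<lambda>h. ((w1, w2), h)) (outputs P f1 f2 w1 w2 i))
      ((w1, w2), h) * pmf (pair_pmf (pmf_of_set {1..M1}) (pmf_of_set {1..M2})) w)"
    unfolding code_law_def pmf_bind
    by (rule integral_measure_pmf_real) (auto simp: set_pmf_eq[symmetric] pmf_eq_0_set_pmf)
  then show ?thesis
    using assms by (simp add: inj pmf_pair)
qed

section \<open>The joint law of messages and outputs after \<open>i\<close> channel uses\<close>

locale feedback_code =
  fixes P :: "('x1::finite, 'x2::finite, 'y1::finite, 'y2::finite, 'f1::finite, 'f2::finite) icgf"
    and f1 :: "('f1, 'x1) encoder" and f2 :: "('f2, 'x2) encoder" and M1 M2 :: nat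
  assumes M1: "1 \<le> M1" and M2: "1 \<le> M2"
begin

text \<open>The sample space after \<open>i\<close> channel uses. Truncating a code at time
  \<open>i\<close> gives a code of block length \<open>i\<close>, so \<open>code_law\<close> itself
  supplies the law \<open>p i\<close> at every time.\<close>

definition St :: "nat \<Rightarrow> ((nat \<times> nat) \<times> ('y1 \<times> 'y2 \<times> 'f1 \<times> 'f2) list) set" where
  "St i = ({1..M1} \<times> {1..M2}) \<times> {h. length h = i}"

abbreviation p :: "nat \<Rightarrow> (nat \<times> nat) \<times> ('y1 \<times> 'y2 \<times> 'f1 \<times> 'f2) list \<Rightarrow> real" where
  "p i \<equiv> pmf (code_law P f1 f2 i M1 M2)"

text \<open>The letter sent next: after \<open>i\<close> past outputs the time index is
  \<open>i + 1\<close>, hence the \<open>Suc\<close>.\<close>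

definition X1 :: "(nat \<times> nat) \<times> ('y1 \<times> 'y2 \<times> 'f1 \<times> 'f2) list \<Rightarrow> 'x1" where
  "X1 = (\<lambda>((w1, w2), h). f1 (Suc (length h)) w1 (map (\<lambda>(y1, y2, z1, z2). z1) h))"

definition X2 :: "(nat \<times> nat) \<times> ('y1 \<times> 'y2 \<times> 'f1 \<times> 'f2) list \<Rightarrow> 'x2" where
  "X2 = (\<lambda>((w1, w2), h). f2 (Suc (length h)) w2 (map (\<lambda>(y1, y2, z1, z2). z2) h))"

definition FB :: "(nat \<times> nat) \<times> ('y1 \<times> 'y2 \<times> 'f1 \<times> 'f2) list \<Rightarrow> ('f1 \<times> 'f2) list" where
  "FB = (\<lambda>(w, h). map (\<lambda>(y1, y2, z1, z2). (z1, z2)) h)"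

abbreviation kern :: "(nat \<times> nat) \<times> ('y1 \<times> 'y2 \<times> 'f1 \<times> 'f2) list \<Rightarrow> 'y1 \<times> 'y2 \<times> 'f1 \<times> 'f2 \<Rightarrow> real" where
  "kern s u \<equiv> pmf (P (X1 s) (X2 s)) u"

text \<open>A transition is a state at time \<open>i\<close> with the next output letter. All
  one-step conditional entropies are taken here, under the weights \<open>q i\<close>.\<close>

abbreviation Tr where "Tr i \<equiv> St i \<times> (UNIV :: ('y1 \<times> 'y2 \<times> 'f1 \<times> 'f2) set)"

abbreviation q where "q i \<equiv> (\<lambda>(s, u). p i s * kern s u)"

lemma finite_St: "finite (St i)"
proof -
  have "finite {h :: ('y1 \<times> 'y2 \<times> 'f1 \<times> 'f2) list. length h = i}"
    using finite_lists_length_eq[of "UNIV :: ('y1 \<times> 'y2 \<times> 'f1 \<times> 'f2) set" i] by simp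
  then show ?thesis by (simp add: St_def)
qed

lemma kern_sum: "(\<Sum>u\<in>UNIV. kern s u) = 1"
  by (rule sum_pmf_eq_1) auto

sublocale W: weighted_set "St i" "p i" for i
  by unfold_locales (auto simp: finite_St)

sublocale K: weighted_set "Tr i" "q i" for i
  by (rule W.weighted_set_kernel) auto

lemma set_code_law: "set_pmf (code_law P f1 f2 i M1 M2) \<subseteq> St i"
  using M1 M2 by (auto simp: code_law_def St_def set_bind_pmf dest: length_outputs)

lemma sum_p: "sum (p i) (St i) = 1"
  by (rule sum_pmf_eq_1[OF finite_St set_code_law])

lemma p_Suc:
  assumes "(w, h) \<in> St i"
  shows "p (Suc i) (w, h @ [u]) = q i ((w, h), u)"
  using assms by (cases w) (auto simp: St_def pmf_code_law pmf_outputs_Suc X1_def X2_def simp del: outputs.simps)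

text \<open>Appending the letter maps transitions bijectively to states at the next time and carries
  \<open>q i\<close> to \<open>p (Suc i)\<close>.\<close>

lemma Ent_Suc: "Ent (St (Suc i)) (p (Suc i)) f = Ent (Tr i) (q i) (\<lambda>((w, h), u). f (w, h @ [u]))"
proof -
  let ?g = "\<lambda>((w, h), u). (w, h @ [u])"
  have "Ent (St (Suc i)) (p (Suc i)) f = Ent (Tr i) (q i) (\<lambda>s. f (?g s))"
  proof (rule Ent_push)
    show "finite (Tr i)" by (simp add: finite_St)
    show "finite (St (Suc i))" by (rule finite_St)
    show "?g ` Tr i \<subseteq> St (Suc i)" by (auto simp: St_def)
    fix s assume s: "s \<in> St (Suc i)"
    obtain w h u where s_eq: "s = (w, h @ [u])"
      using s by (cases s, cases "snd s" rule: rev_cases) (auto simp: St_def)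
    have "{s' \<in> Tr i. ?g s' = s} = {((w, h), u)}"
      using s by (auto simp: s_eq St_def)
    moreover have "(w, h) \<in> St i" using s by (auto simp: s_eq St_def)
    ultimately show "p (Suc i) s = marg (Tr i) (q i) ?g s"
      by (simp add: marg_def p_Suc s_eq)
  qed
  then show ?thesis by (simp add: case_prod_unfold)
qed

lemma Ent_St: "Ent (St i) (p i) f = Ent (Tr i) (q i) (\<lambda>(s, u). f s)"
  by (rule W.Ent_kernel_fst[symmetric]) (auto simp: kern_sum)

lemma cond_Ent_memoryless_eq:
  assumes "\<And>s s'. s \<in> St i \<Longrightarrow> s' \<in> St i \<Longrightarrow> Z s = Z s' \<Longrightarrow> X1 s = X1 s' \<and> X2 s = X2 s'"
  shows "cond_Ent (Tr i) (q i) (\<lambda>(s, u). g u) (\<lambda>(s, u). Z s) =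
    (\<Sum>s\<in>St i. p i s * Ent UNIV (kern s) g)"
proof (rule W.cond_Ent_kernel)
  fix s s' assume "s \<in> St i" "s' \<in> St i" "Z s = Z s'"
  from assms[OF this] show "kern s = kern s'" by auto
qed (simp_all add: kern_sum)

lemma cond_Ent_memoryless:
  assumes "\<And>s s'. s \<in> St i \<Longrightarrow> s' \<in> St i \<Longrightarrow> Z s = Z s' \<Longrightarrow> X1 s = X1 s' \<and> X2 s = X2 s'"
    and "\<And>s s'. s \<in> St i \<Longrightarrow> s' \<in> St i \<Longrightarrow> Z' s = Z' s' \<Longrightarrow> X1 s = X1 s' \<and> X2 s = X2 s'"
  shows "cond_Ent (Tr i) (q i) (\<lambda>(s, u). g u) (\<lambda>(s, u). Z s) =
    cond_Ent (Tr i) (q i) (\<lambda>(s, u). g u) (\<lambda>(s, u). Z' s)"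
  by (rule trans[OF cond_Ent_memoryless_eq cond_Ent_memoryless_eq[symmetric]])
    (use assms in blast)+

end

subsection \<open>One step of the telescoping sums\<close>

context feedback_code
begin

text \<open>The chain rule: a quantity that grows by \<open>g u\<close> in one step gains the
  conditional entropy of \<open>g u\<close> given its old value.\<close>

lemma Ent_step:
  assumes "\<And>w h u w' h' u'. (w, h) \<in> St i \<Longrightarrow> (w', h') \<in> St i \<Longrightarrow>
    f (w, h @ [u]) = f (w', h' @ [u']) \<longleftrightarrow> g u = g u' \<and> F (w, h) = F (w', h')"
  shows "Ent (St (Suc i)) (p (Suc i)) f - Ent (St i) (p i) F =
    cond_Ent (Tr i) (q i) (\<lambda>(s, u). g u) (\<lambda>(s, u). F s)"
proof -
  have "Ent (Tr i) (q i) (\<lambda>((w, h), u). f (w, h @ [u])) =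
      Ent (Tr i) (q i) (\<lambda>r. (case r of (s, u) \<Rightarrow> g u, case r of (s, u) \<Rightarrow> F s))"
    by (rule Ent_fun_cong) (clarsimp simp: assms)
  then show ?thesis
    unfolding cond_Ent_def Ent_Suc[of i f] Ent_St[of i F] by simp
qed

text \<open>Up to the constant entropy of the messages, the left-hand side is the increment of the
  information between both messages and the letters \<open>c\<close>. Forgetting part of the past
  raises the entropy of the new letter, and given the whole state it depends on the inputs only.
  \<open>Z\<close> is trivial in the bounds without \<open>T\<close> and is the past feedback in the
  bound with \<open>T\<close>.\<close>

lemma step_total:
  assumes Z: "\<And>s s'. s \<in> St i \<Longrightarrow> s' \<in> St i \<Longrightarrow> map c (snd s) = map c (snd s') \<Longrightarrow> Z s = Z s'"
  shows "(Ent (St (Suc i)) (p (Suc i)) (\<lambda>s. map c (snd s))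
        - Ent (St (Suc i)) (p (Suc i)) (\<lambda>s. (fst s, map c (snd s))))
      - (Ent (St i) (p i) (\<lambda>s. map c (snd s)) - Ent (St i) (p i) (\<lambda>s. (fst s, map c (snd s))))
    \<le> cmi (Tr i) (q i) (\<lambda>(s, u). (X1 s, X2 s)) (\<lambda>(s, u). c u) (\<lambda>(s, u). Z s)"
proof -
  let ?H = "\<lambda>Z. cond_Ent (Tr i) (q i) (\<lambda>(s, u). c u) Z"
  have "Ent (St (Suc i)) (p (Suc i)) (\<lambda>s. map c (snd s)) - Ent (St i) (p i) (\<lambda>s. map c (snd s)) =
      ?H (\<lambda>(s, u). map c (snd s))"
    by (rule Ent_step) auto
  moreover have "Ent (St (Suc i)) (p (Suc i)) (\<lambda>s. (fst s, map c (snd s)))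
      - Ent (St i) (p i) (\<lambda>s. (fst s, map c (snd s))) = ?H (\<lambda>(s, u). (fst s, map c (snd s)))"
    by (rule Ent_step) auto
  moreover have "?H (\<lambda>(s, u). map c (snd s)) \<le> ?H (\<lambda>(s, u). Z s)"
    by (intro K.cond_Ent_mono) (clarsimp, rule Z, auto)
  moreover have "?H (\<lambda>(s, u). s) \<le> ?H (\<lambda>(s, u). (fst s, map c (snd s)))"
    by (intro K.cond_Ent_mono) auto
  moreover have "?H (\<lambda>(s, u). s) = ?H (\<lambda>(s, u). ((X1 s, X2 s), Z s))"
    by (rule cond_Ent_memoryless) auto
  moreover have "?H (\<lambda>(s, u). ((X1 s, X2 s), Z s)) =
      ?H (\<lambda>p. (case p of (s, u) \<Rightarrow> (X1 s, X2 s), case p of (s, u) \<Rightarrow> Z s))"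
    by (rule K.cond_Ent_cong) auto
  ultimately show ?thesis unfolding cmi_def by linarith
qed

lemma X1_eq: "fst (fst s) = fst (fst s') \<Longrightarrow> FB s = FB s' \<Longrightarrow> X1 s = X1 s'"
proof -
  have "map (\<lambda>(y1, y2, z1, z2). z1) (snd s) = map fst (FB s)" for s
    by (auto simp: FB_def split: prod.splits)
  moreover have "length (snd s) = length (FB s)" for s by (auto simp: FB_def split: prod.splits)
  ultimately show "fst (fst s) = fst (fst s') \<Longrightarrow> FB s = FB s' \<Longrightarrow> X1 s = X1 s'"
    unfolding X1_def by (simp add: case_prod_unfold)
qed

lemma X2_eq: "snd (fst s) = snd (fst s') \<Longrightarrow> FB s = FB s' \<Longrightarrow> X2 s = X2 s'"
proof -
  have "map (\<lambda>(y1, y2, z1, z2). z2) (snd s) = map snd (FB s)" for s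
    by (auto simp: FB_def split: prod.splits)
  moreover have "length (snd s) = length (FB s)" for s by (auto simp: FB_def split: prod.splits)
  ultimately show "snd (fst s) = snd (fst s') \<Longrightarrow> FB s = FB s' \<Longrightarrow> X2 s = X2 s'"
    unfolding X2_def by (simp add: case_prod_unfold)
qed

lemma FB_eq: "snd s = snd s' \<Longrightarrow> FB s = FB s'"
  by (simp add: FB_def case_prod_unfold)

text \<open>The increment of the information on message 1 in all outputs, given message 2. Message 2
  and the past outputs determine \<open>X2\<close> and \<open>FB\<close>, so conditioning on these
  alone raises the positive entropy; the negative one is fixed by the inputs.\<close>

lemma step_user1:
  "(Ent (St (Suc i)) (p (Suc i)) (\<lambda>s. (snd (fst s), snd s)) - Ent (St (Suc i)) (p (Suc i)) (\<lambda>s. s))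
      - (Ent (St i) (p i) (\<lambda>s. (snd (fst s), snd s)) - Ent (St i) (p i) (\<lambda>s. s))
    \<le> cmi (Tr i) (q i) (\<lambda>(s, u). X1 s) (\<lambda>(s, u). u) (\<lambda>(s, u). (X2 s, FB s))"
proof -
  let ?H = "\<lambda>Z. cond_Ent (Tr i) (q i) (\<lambda>(s, u). u) Z"
  have "Ent (St (Suc i)) (p (Suc i)) (\<lambda>s. (snd (fst s), snd s)) - Ent (St i) (p i) (\<lambda>s. (snd (fst s), snd s)) =
      ?H (\<lambda>(s, u). (snd (fst s), snd s))"
    by (rule Ent_step) auto
  moreover have "Ent (St (Suc i)) (p (Suc i)) (\<lambda>s. s) - Ent (St i) (p i) (\<lambda>s. s) = ?H (\<lambda>(s, u). s)"
    by (rule Ent_step) auto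
  moreover have "?H (\<lambda>(s, u). (snd (fst s), snd s)) \<le> ?H (\<lambda>(s, u). (X2 s, FB s))"
    by (intro K.cond_Ent_mono) (auto intro!: X2_eq FB_eq)
  moreover have "?H (\<lambda>(s, u). s) = ?H (\<lambda>(s, u). (X1 s, X2 s, FB s))"
    by (rule cond_Ent_memoryless) auto
  moreover have "?H (\<lambda>(s, u). (X1 s, X2 s, FB s)) =
      ?H (\<lambda>p. (case p of (s, u) \<Rightarrow> X1 s, case p of (s, u) \<Rightarrow> (X2 s, FB s)))"
    by (rule K.cond_Ent_cong) auto
  ultimately show ?thesis unfolding cmi_def by linarith
qed

lemma step_user2:
  "(Ent (St (Suc i)) (p (Suc i)) (\<lambda>s. (fst (fst s), snd s)) - Ent (St (Suc i)) (p (Suc i)) (\<lambda>s. s))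
      - (Ent (St i) (p i) (\<lambda>s. (fst (fst s), snd s)) - Ent (St i) (p i) (\<lambda>s. s))
    \<le> cmi (Tr i) (q i) (\<lambda>(s, u). X2 s) (\<lambda>(s, u). u) (\<lambda>(s, u). (X1 s, FB s))"
proof -
  let ?H = "\<lambda>Z. cond_Ent (Tr i) (q i) (\<lambda>(s, u). u) Z"
  have "Ent (St (Suc i)) (p (Suc i)) (\<lambda>s. (fst (fst s), snd s)) - Ent (St i) (p i) (\<lambda>s. (fst (fst s), snd s)) =
      ?H (\<lambda>(s, u). (fst (fst s), snd s))"
    by (rule Ent_step) auto
  moreover have "Ent (St (Suc i)) (p (Suc i)) (\<lambda>s. s) - Ent (St i) (p i) (\<lambda>s. s) = ?H (\<lambda>(s, u). s)"
    by (rule Ent_step) auto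
  moreover have "?H (\<lambda>(s, u). (fst (fst s), snd s)) \<le> ?H (\<lambda>(s, u). (X1 s, FB s))"
    by (intro K.cond_Ent_mono) (auto intro!: X1_eq FB_eq)
  moreover have "?H (\<lambda>(s, u). s) = ?H (\<lambda>(s, u). (X2 s, X1 s, FB s))"
    by (rule cond_Ent_memoryless) auto
  moreover have "?H (\<lambda>(s, u). (X2 s, X1 s, FB s)) =
      ?H (\<lambda>p. (case p of (s, u) \<Rightarrow> X2 s, case p of (s, u) \<Rightarrow> (X1 s, FB s)))"
    by (rule K.cond_Ent_cong) auto
  ultimately show ?thesis unfolding cmi_def by linarith
qed

text \<open>The mutual information of the two messages given the feedback of both users up to time
  \<open>i\<close>.\<close>

definition dep :: "nat \<Rightarrow> real" where
  "dep i = Ent (St i) (p i) (\<lambda>s. (fst (fst s), FB s)) + Ent (St i) (p i) (\<lambda>s. (snd (fst s), FB s))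
    - Ent (St i) (p i) FB - Ent (St i) (p i) (\<lambda>s. (fst s, FB s))"

text \<open>By \<open>cmi_diff\<close> both sides are combinations of conditional entropies of the
  new feedback pair. Each message with the past feedback determines its input, so passing to the
  input raises the two positive terms. The term with both messages is unchanged by memorylessness,
  and the term with neither is common to both sides.\<close>

lemma step_dependence:
  "dep (Suc i) - dep i \<le>
    cmi (Tr i) (q i) (\<lambda>(s, u). X1 s) (\<lambda>(s, u). X2 s)
      (\<lambda>r. (case r of (s, (y1, y2, z1, z2)) \<Rightarrow> (z1, z2), case r of (s, u) \<Rightarrow> FB s))
    - cmi (Tr i) (q i) (\<lambda>(s, u). X1 s) (\<lambda>(s, u). X2 s) (\<lambda>(s, u). FB s)"
proof -
  let ?H = "\<lambda>Z. cond_Ent (Tr i) (q i) (\<lambda>(s, u). case u of (y1, y2, z1, z2) \<Rightarrow> (z1, z2)) Z"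
  note step = Ent_step[where g = "\<lambda>(y1, y2, z1, z2). (z1, z2)"]
  have "Ent (St (Suc i)) (p (Suc i)) (\<lambda>s. (fst (fst s), FB s)) - Ent (St i) (p i) (\<lambda>s. (fst (fst s), FB s))
      = ?H (\<lambda>(s, u). (fst (fst s), FB s))"
    by (rule step) (auto simp: FB_def)
  moreover have "Ent (St (Suc i)) (p (Suc i)) (\<lambda>s. (snd (fst s), FB s)) - Ent (St i) (p i) (\<lambda>s. (snd (fst s), FB s))
      = ?H (\<lambda>(s, u). (snd (fst s), FB s))"
    by (rule step) (auto simp: FB_def)
  moreover have "Ent (St (Suc i)) (p (Suc i)) (\<lambda>s. (fst s, FB s)) - Ent (St i) (p i) (\<lambda>s. (fst s, FB s))
      = ?H (\<lambda>(s, u). (fst s, FB s))"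
    by (rule step) (auto simp: FB_def)
  moreover have "Ent (St (Suc i)) (p (Suc i)) FB - Ent (St i) (p i) FB = ?H (\<lambda>(s, u). FB s)"
    by (rule step) (auto simp: FB_def)
  moreover have "?H (\<lambda>(s, u). (fst (fst s), FB s)) \<le> ?H (\<lambda>r. (case r of (s, u) \<Rightarrow> X1 s, case r of (s, u) \<Rightarrow> FB s))"
    by (intro K.cond_Ent_mono) (auto intro!: X1_eq)
  moreover have "?H (\<lambda>(s, u). (snd (fst s), FB s)) \<le> ?H (\<lambda>r. (case r of (s, u) \<Rightarrow> X2 s, case r of (s, u) \<Rightarrow> FB s))"
    by (intro K.cond_Ent_mono) (auto intro!: X2_eq)
  moreover have "?H (\<lambda>(s, u). (X1 s, X2 s, FB s)) = ?H (\<lambda>(s, u). (fst s, FB s))"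
    by (rule cond_Ent_memoryless) (auto intro!: X1_eq X2_eq)
  moreover have "?H (\<lambda>(s, u). (X1 s, X2 s, FB s)) =
      ?H (\<lambda>r. (case r of (s, u) \<Rightarrow> X1 s, case r of (s, u) \<Rightarrow> X2 s, case r of (s, u) \<Rightarrow> FB s))"
    by (rule K.cond_Ent_cong) auto
  ultimately show ?thesis
    unfolding cmi_diff dep_def by linarith
qed

end

subsection \<open>Slices of the input law\<close>

definition joint_weight :: "('x1, 'x2, 'y1, 'y2, 'f1, 'f2) icgf \<Rightarrow> ('x1 \<times> 'x2 \<Rightarrow> real) \<Rightarrow>
    'x1 \<times> 'x2 \<times> 'y1 \<times> 'y2 \<times> 'f1 \<times> 'f2 \<Rightarrow> real" where
  "joint_weight P b = (\<lambda>(x1, x2, u). b (x1, x2) * pmf (P x1 x2) u)"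

context feedback_code
begin

text \<open>The mass of a slice is the probability of the past feedback \<open>t\<close>; it is not
  renormalized to a conditional law.\<close>

definition slice :: "nat \<Rightarrow> ('f1 \<times> 'f2) list \<Rightarrow> 'x1 \<times> 'x2 \<Rightarrow> real" where
  "slice i t x = marg (St i) (p i) (\<lambda>s. ((X1 s, X2 s), FB s)) (x, t)"

lemma slice_nonneg: "0 \<le> slice i t x"
  unfolding slice_def by (intro marg_nonneg) auto

lemma sum_slice: "(\<Sum>t\<in>FB ` St i. slice i t x) = marg (St i) (p i) (\<lambda>s. (X1 s, X2 s)) x"
proof -
  have "slice i t x = (\<Sum>s | s \<in> {s \<in> St i. (X1 s, X2 s) = x} \<and> FB s = t. p i s)" for t
    unfolding slice_def marg_def by (intro sum.cong) auto
  then have "(\<Sum>t\<in>FB ` St i. slice i t x) =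
      (\<Sum>t\<in>FB ` St i. \<Sum>s | s \<in> {s \<in> St i. (X1 s, X2 s) = x} \<and> FB s = t. p i s)"
    by (simp only:)
  also have "\<dots> = (\<Sum>s | s \<in> St i \<and> (X1 s, X2 s) = x. p i s)"
    using finite_St by (intro sum.group) auto
  finally show ?thesis unfolding marg_def .
qed

lemma sum_slice_total: "(\<Sum>t\<in>FB ` St i. \<Sum>x\<in>UNIV. slice i t x) = 1"
proof -
  have "(\<Sum>t\<in>FB ` St i. \<Sum>x\<in>UNIV. slice i t x) = (\<Sum>x\<in>UNIV. marg (St i) (p i) (\<lambda>s. (X1 s, X2 s)) x * 1)"
    by (subst sum.swap) (simp add: sum_slice)
  also have "\<dots> = (\<Sum>s\<in>St i. p i s * 1)"
    by (rule sum_marg) (auto simp: finite_St)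
  finally show ?thesis by (simp add: sum_p)
qed

text \<open>Grouping the transitions by past feedback and forgetting the messages leaves, for each
  \<open>t\<close>, the slice passed through the channel. No factor for the probability of
  \<open>t\<close> is written, since the slice contains it.\<close>

lemma cmi_slices:
  "cmi (Tr i) (q i) (\<lambda>(s, u). X (X1 s, X2 s, u)) (\<lambda>(s, u). Y (X1 s, X2 s, u))
      (\<lambda>(s, u). (Z (X1 s, X2 s, u), FB s)) =
    (\<Sum>t\<in>FB ` St i. cmi UNIV (joint_weight P (slice i t)) X Y Z)"
proof -
  let ?g = "\<lambda>(s, u). (FB s, (X1 s, X2 s, u))"
  let ?b = "\<lambda>(t, r). joint_weight P (slice i t) r"
  have "cmi (FB ` St i \<times> UNIV) ?b (\<lambda>(l, r). X r) (\<lambda>(l, r). Y r) (\<lambda>(l, r). (Z r, l)) =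
      cmi (Tr i) (q i) (\<lambda>s. (\<lambda>(l, r). X r) (?g s)) (\<lambda>s. (\<lambda>(l, r). Y r) (?g s)) (\<lambda>s. (\<lambda>(l, r). (Z r, l)) (?g s))"
  proof (rule cmi_push)
    fix v assume "v \<in> FB ` St i \<times> (UNIV :: ('x1 \<times> 'x2 \<times> 'y1 \<times> 'y2 \<times> 'f1 \<times> 'f2) set)"
    obtain t x1 x2 u where v: "v = (t, x1, x2, u)" by (cases v) auto
    have "{s \<in> Tr i. ?g s = v} = {s \<in> St i. ((X1 s, X2 s), FB s) = ((x1, x2), t)} \<times> {u}"
      by (auto simp: v)
    then have "marg (Tr i) (q i) ?g v =
        sum (q i) ({s \<in> St i. ((X1 s, X2 s), FB s) = ((x1, x2), t)} \<times> {u})"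
      unfolding marg_def by (simp only:)
    also have "\<dots> = (\<Sum>s | s \<in> St i \<and> ((X1 s, X2 s), FB s) = ((x1, x2), t). p i s * pmf (P x1 x2) u)"
      unfolding sum.cartesian_product' by (intro sum.cong) auto
    finally show "?b v = marg (Tr i) (q i) ?g v"
      by (simp add: v joint_weight_def slice_def marg_def sum_distrib_right)
  qed (auto simp: finite_St)
  also have "cmi (FB ` St i \<times> UNIV) ?b (\<lambda>(l, r). X r) (\<lambda>(l, r). Y r) (\<lambda>(l, r). (Z r, l)) =
      (\<Sum>t\<in>FB ` St i. cmi UNIV (joint_weight P (slice i t)) X Y Z)"
    by (subst cmi_split) (auto simp: finite_St)
  finally show ?thesis by (simp add: case_prod_unfold)
qed

lemma cmi_unconditioned:
  "cmi (Tr i) (q i) (\<lambda>(s, u). X (X1 s, X2 s, u)) (\<lambda>(s, u). Y (X1 s, X2 s, u)) (\<lambda>_. ()) =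
    cmi UNIV (joint_weight P (\<lambda>x. \<Sum>t\<in>FB ` St i. slice i t x)) X Y (\<lambda>_. ())"
proof -
  let ?g = "\<lambda>(s, u). (X1 s, X2 s, u)"
  let ?b = "joint_weight P (\<lambda>x. \<Sum>t\<in>FB ` St i. slice i t x)"
  have "cmi UNIV ?b X Y (\<lambda>_. ()) = cmi (Tr i) (q i) (\<lambda>s. X (?g s)) (\<lambda>s. Y (?g s)) (\<lambda>s. ())"
  proof (rule cmi_push)
    fix v :: "'x1 \<times> 'x2 \<times> 'y1 \<times> 'y2 \<times> 'f1 \<times> 'f2"
    obtain x1 x2 u where v: "v = (x1, x2, u)" by (cases v) auto
    have "{s \<in> Tr i. ?g s = v} = {s \<in> St i. (X1 s, X2 s) = (x1, x2)} \<times> {u}"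
      by (auto simp: v)
    then have "marg (Tr i) (q i) ?g v = sum (q i) ({s \<in> St i. (X1 s, X2 s) = (x1, x2)} \<times> {u})"
      unfolding marg_def by (simp only:)
    also have "\<dots> = (\<Sum>s | s \<in> St i \<and> (X1 s, X2 s) = (x1, x2). p i s * pmf (P x1 x2) u)"
      unfolding sum.cartesian_product' by (intro sum.cong) auto
    finally show "?b v = marg (Tr i) (q i) ?g v"
      by (simp add: v joint_weight_def sum_slice marg_def sum_distrib_right)
  qed (auto simp: finite_St)
  then show ?thesis by (simp add: case_prod_unfold)
qed

end

subsection \<open>The multi-letter bounds\<close>

context weighted_set
begin

lemma Ent_trivial:
  assumes "sum a S = 1" "\<And>s s'. s \<in> S \<Longrightarrow> s' \<in> S \<Longrightarrow> f s = f s'"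
  shows "Ent S a f = 0"
proof -
  have "Ent S a f = Ent S a (\<lambda>_. ())"
    by (rule Ent_fun_cong) (use assms(2) in blast)
  then show ?thesis by (simp add: Ent_const assms(1))
qed

lemma Ent_le_log_card:
  assumes "X ` S \<subseteq> V" "finite V" "sum a S = 1"
  shows "Ent S a X \<le> log 2 (card V)"
proof -
  have "Ent S a (\<lambda>s. (X s, ())) = Ent S a X"
    by (rule Ent_fun_cong) auto
  then show ?thesis
    using cond_Ent_le_log_card[OF assms, of "\<lambda>_. ()"] assms(3)
    by (simp add: cond_Ent_def Ent_const)
qed

end

context feedback_code
begin

lemma St_0: "s \<in> St 0 \<Longrightarrow> snd s = []"
  by (auto simp: St_def)

text \<open>Uniformity and independence of the messages enter here: with an empty history each
  sample point has mass \<open>1 / (M1 * M2)\<close>.\<close>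

lemma Ent_start:
  assumes "\<And>s s'. s \<in> St 0 \<Longrightarrow> s' \<in> St 0 \<Longrightarrow> f s = f s' \<longleftrightarrow> fst s = fst s'"
  shows "Ent (St 0) (p 0) f = log 2 M1 + log 2 M2"
proof -
  have "Ent (St 0) (p 0) f = Ent (St 0) (p 0) (\<lambda>s. s)"
  proof (rule Ent_fun_cong)
    fix s s' assume s: "s \<in> St 0" "s' \<in> St 0"
    then have "snd s = snd s'" by (auto simp: St_def)
    then show "f s = f s' \<longleftrightarrow> s = s'" using assms[OF s] prod_eq_iff by blast
  qed
  also have "\<dots> = (\<Sum>s\<in>St 0. p 0 s * (log 2 M1 + log 2 M2))"
    unfolding Ent_def
  proof (rule sum.cong)
    fix s assume s: "s \<in> St 0"
    then have "{s' \<in> St 0. s' = s} = {s}" by auto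
    moreover have "p 0 s = 1 / (real M1 * real M2)"
      using s by (auto simp: St_def pmf_code_law)
    ultimately show "p 0 s * - log 2 (marg (St 0) (p 0) (\<lambda>s. s) s) = p 0 s * (log 2 M1 + log 2 M2)"
      using M1 M2 by (simp add: marg_def log_divide log_mult)
  qed simp
  also have "\<dots> = log 2 M1 + log 2 M2"
    using sum_p[of 0] by (simp add: sum_distrib_right[symmetric])
  finally show ?thesis .
qed

lemma Ent_start1:
  assumes "\<And>s s'. s \<in> St 0 \<Longrightarrow> s' \<in> St 0 \<Longrightarrow> f s = f s' \<longleftrightarrow> fst (fst s) = fst (fst s')"
  shows "Ent (St 0) (p 0) f \<le> log 2 M1"
proof -
  have "Ent (St 0) (p 0) f = Ent (St 0) (p 0) (\<lambda>s. fst (fst s))"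
    by (rule Ent_fun_cong) (rule assms)
  also have "\<dots> \<le> log 2 (card {1..M1})"
    by (rule W.Ent_le_log_card[OF _ _ sum_p]) (auto simp: St_def)
  finally show ?thesis by simp
qed

lemma Ent_start2:
  assumes "\<And>s s'. s \<in> St 0 \<Longrightarrow> s' \<in> St 0 \<Longrightarrow> f s = f s' \<longleftrightarrow> snd (fst s) = snd (fst s')"
  shows "Ent (St 0) (p 0) f \<le> log 2 M2"
proof -
  have "Ent (St 0) (p 0) f = Ent (St 0) (p 0) (\<lambda>s. snd (fst s))"
    by (rule Ent_fun_cong) (rule assms)
  also have "\<dots> \<le> log 2 (card {1..M2})"
    by (rule W.Ent_le_log_card[OF _ _ sum_p]) (auto simp: St_def)
  finally show ?thesis by simp
qed

text \<open>The telescoped quantity \<open>A i\<close> is minus the entropy of the messages given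
  the first \<open>i\<close> letters \<open>c\<close>. The left-hand side is thus the information
  between the messages and all \<open>n\<close> letters.\<close>

lemma sum_total:
  assumes "\<And>i s s'. s \<in> St i \<Longrightarrow> s' \<in> St i \<Longrightarrow> map c (snd s) = map c (snd s') \<Longrightarrow> Z s = Z s'"
  shows "log 2 M1 + log 2 M2 - cond_Ent (St n) (p n) fst (\<lambda>s. map c (snd s))
    \<le> (\<Sum>i<n. cmi (Tr i) (q i) (\<lambda>(s, u). (X1 s, X2 s)) (\<lambda>(s, u). c u) (\<lambda>(s, u). Z s))"
proof -
  define A where "A i = Ent (St i) (p i) (\<lambda>s. map c (snd s)) - Ent (St i) (p i) (\<lambda>s. (fst s, map c (snd s)))" for i
  have "A 0 = - (log 2 M1 + log 2 M2)"
    unfolding A_def using W.Ent_trivial[OF sum_p[of 0], of "\<lambda>s. map c (snd s)"]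
      Ent_start[of "\<lambda>s. (fst s, map c (snd s))"] by (simp add: St_0)
  moreover have "A n = - cond_Ent (St n) (p n) fst (\<lambda>s. map c (snd s))"
    by (simp add: A_def cond_Ent_def)
  moreover have "A n - A 0 = (\<Sum>i<n. A (Suc i) - A i)"
    by (rule sum_lessThan_telescope[symmetric])
  moreover have "\<dots> \<le> (\<Sum>i<n. cmi (Tr i) (q i) (\<lambda>(s, u). (X1 s, X2 s)) (\<lambda>(s, u). c u) (\<lambda>(s, u). Z s))"
    unfolding A_def by (intro sum_mono step_total assms)
  ultimately show ?thesis by linarith
qed

text \<open>The left-hand side is the information between message 1 and all outputs given message 2,
  the messages being independent.\<close>

lemma sum_user1:
  "log 2 M1 - cond_Ent (St n) (p n) (\<lambda>s. fst (fst s)) (\<lambda>s. (snd (fst s), snd s))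
    \<le> (\<Sum>i<n. cmi (Tr i) (q i) (\<lambda>(s, u). X1 s) (\<lambda>(s, u). u) (\<lambda>(s, u). (X2 s, FB s)))"
proof -
  define A where "A i = Ent (St i) (p i) (\<lambda>s. (snd (fst s), snd s)) - Ent (St i) (p i) (\<lambda>s. s)" for i
  have "A 0 \<le> - log 2 M1"
    unfolding A_def using Ent_start2[of "\<lambda>s. (snd (fst s), snd s)"] Ent_start[of "\<lambda>s. s"]
    by (simp add: St_0 prod_eq_iff)
  moreover have "Ent (St n) (p n) (\<lambda>s. s) = Ent (St n) (p n) (\<lambda>s. (fst (fst s), snd (fst s), snd s))"
    by (rule Ent_fun_cong) auto
  then have "A n = - cond_Ent (St n) (p n) (\<lambda>s. fst (fst s)) (\<lambda>s. (snd (fst s), snd s))"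
    by (simp add: A_def cond_Ent_def)
  moreover have "A n - A 0 = (\<Sum>i<n. A (Suc i) - A i)"
    by (rule sum_lessThan_telescope[symmetric])
  moreover have "\<dots> \<le> (\<Sum>i<n. cmi (Tr i) (q i) (\<lambda>(s, u). X1 s) (\<lambda>(s, u). u) (\<lambda>(s, u). (X2 s, FB s)))"
    unfolding A_def by (intro sum_mono step_user1)
  ultimately show ?thesis by linarith
qed

lemma sum_user2:
  "log 2 M2 - cond_Ent (St n) (p n) (\<lambda>s. snd (fst s)) (\<lambda>s. (fst (fst s), snd s))
    \<le> (\<Sum>i<n. cmi (Tr i) (q i) (\<lambda>(s, u). X2 s) (\<lambda>(s, u). u) (\<lambda>(s, u). (X1 s, FB s)))"
proof -
  define A where "A i = Ent (St i) (p i) (\<lambda>s. (fst (fst s), snd s)) - Ent (St i) (p i) (\<lambda>s. s)" for i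
  have "A 0 \<le> - log 2 M2"
    unfolding A_def using Ent_start1[of "\<lambda>s. (fst (fst s), snd s)"] Ent_start[of "\<lambda>s. s"]
    by (simp add: St_0 prod_eq_iff)
  moreover have "Ent (St n) (p n) (\<lambda>s. s) = Ent (St n) (p n) (\<lambda>s. (snd (fst s), fst (fst s), snd s))"
    by (rule Ent_fun_cong) auto
  then have "A n = - cond_Ent (St n) (p n) (\<lambda>s. snd (fst s)) (\<lambda>s. (fst (fst s), snd s))"
    by (simp add: A_def cond_Ent_def)
  moreover have "A n - A 0 = (\<Sum>i<n. A (Suc i) - A i)"
    by (rule sum_lessThan_telescope[symmetric])
  moreover have "\<dots> \<le> (\<Sum>i<n. cmi (Tr i) (q i) (\<lambda>(s, u). X2 s) (\<lambda>(s, u). u) (\<lambda>(s, u). (X1 s, FB s)))"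
    unfolding A_def by (intro sum_mono step_user2)
  ultimately show ?thesis by linarith
qed

text \<open>The messages are independent to begin with, and their dependence given the feedback
  can never become negative.\<close>

lemma sum_dependence:
  "0 \<le> (\<Sum>i<n. cmi (Tr i) (q i) (\<lambda>(s, u). X1 s) (\<lambda>(s, u). X2 s)
      (\<lambda>r. (case r of (s, (y1, y2, z1, z2)) \<Rightarrow> (z1, z2), case r of (s, u) \<Rightarrow> FB s))
    - cmi (Tr i) (q i) (\<lambda>(s, u). X1 s) (\<lambda>(s, u). X2 s) (\<lambda>(s, u). FB s))"
proof -
  have FB_0: "FB s = []" if "s \<in> St 0" for s
    using that by (auto simp: St_def FB_def)
  have "dep 0 \<le> 0"
    unfolding dep_def using W.Ent_trivial[OF sum_p[of 0], of FB]
      Ent_start[of "\<lambda>s. (fst s, FB s)"] Ent_start1[of "\<lambda>s. (fst (fst s), FB s)"]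
      Ent_start2[of "\<lambda>s. (snd (fst s), FB s)"] by (simp add: FB_0)
  moreover have "0 \<le> dep n"
  proof -
    have "Ent (St n) (p n) (\<lambda>s. (snd (fst s), fst (fst s), FB s)) = Ent (St n) (p n) (\<lambda>s. (fst s, FB s))"
      by (rule Ent_fun_cong) auto
    then show ?thesis
      using W.cmi_nonneg[of n "\<lambda>s. fst (fst s)" "\<lambda>s. snd (fst s)" FB]
      unfolding cmi_def cond_Ent_def dep_def by linarith
  qed
  moreover have "dep n - dep 0 = (\<Sum>i<n. dep (Suc i) - dep i)"
    by (rule sum_lessThan_telescope[symmetric])
  moreover have "\<dots> \<le> (\<Sum>i<n. cmi (Tr i) (q i) (\<lambda>(s, u). X1 s) (\<lambda>(s, u). X2 s)
      (\<lambda>r. (case r of (s, (y1, y2, z1, z2)) \<Rightarrow> (z1, z2), case r of (s, u) \<Rightarrow> FB s))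
    - cmi (Tr i) (q i) (\<lambda>(s, u). X1 s) (\<lambda>(s, u). X2 s) (\<lambda>(s, u). FB s))"
    by (intro sum_mono step_dependence)
  ultimately show ?thesis by linarith
qed

section \<open>Fano's inequality at the two receivers\<close>

lemma prob_code_law: "measure_pmf.prob (code_law P f1 f2 n M1 M2) A = (\<Sum>s | s \<in> St n \<and> s \<in> A. p n s)"
proof -
  have "A \<inter> set_pmf (code_law P f1 f2 n M1 M2) = (St n \<inter> A) \<inter> set_pmf (code_law P f1 f2 n M1 M2)"
    using set_code_law[of n] by auto
  then have "measure_pmf.prob (code_law P f1 f2 n M1 M2) A = measure_pmf.prob (code_law P f1 f2 n M1 M2) (St n \<inter> A)"
    by (metis measure_Int_set_pmf)
  also have "\<dots> = sum (p n) (St n \<inter> A)"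
    by (rule measure_measure_pmf_finite) (simp add: finite_St)
  finally show ?thesis by (simp add: Int_def)
qed

lemma fano1:
  assumes "is_code P n M1 M2 e1 e2 f1 f2 g1 g2"
  shows "cond_Ent (St n) (p n) (\<lambda>s. fst (fst s)) (\<lambda>s. map (\<lambda>(y1, y2, z1, z2). y1) (snd s)) \<le> 1 + e1 * log 2 M1"
proof -
  have "e1 = (\<Sum>s | s \<in> St n \<and> g1 (map (\<lambda>(y1, y2, z1, z2). y1) (snd s)) \<noteq> fst (fst s). p n s)"
    using assms unfolding is_code_def prob_code_law by (simp add: case_prod_unfold)
  moreover have "(\<lambda>s. fst (fst s)) ` St n \<subseteq> {1..M1}" by (auto simp: St_def)
  ultimately show ?thesis
    using W.fano[of "\<lambda>s. fst (fst s)" n "{1..M1}" M1 "\<lambda>s. map (\<lambda>(y1, y2, z1, z2). y1) (snd s)" g1]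
    by (simp add: sum_p)
qed

lemma fano2:
  assumes "is_code P n M1 M2 e1 e2 f1 f2 g1 g2"
  shows "cond_Ent (St n) (p n) (\<lambda>s. snd (fst s)) (\<lambda>s. map (\<lambda>(y1, y2, z1, z2). y2) (snd s)) \<le> 1 + e2 * log 2 M2"
proof -
  have "e2 = (\<Sum>s | s \<in> St n \<and> g2 (map (\<lambda>(y1, y2, z1, z2). y2) (snd s)) \<noteq> snd (fst s). p n s)"
    using assms unfolding is_code_def prob_code_law by (simp add: case_prod_unfold)
  moreover have "(\<lambda>s. snd (fst s)) ` St n \<subseteq> {1..M2}" by (auto simp: St_def)
  ultimately show ?thesis
    using W.fano[of "\<lambda>s. snd (fst s)" n "{1..M2}" M2 "\<lambda>s. map (\<lambda>(y1, y2, z1, z2). y2) (snd s)" g2]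
    by (simp add: sum_p)
qed

text \<open>The chain rule, stated in both orders so that Fano's inequality can treat either message
  while the other one is bounded by its size.\<close>

lemma cond_Ent_messages1:
  "cond_Ent (St n) (p n) fst Z =
    cond_Ent (St n) (p n) (\<lambda>s. fst (fst s)) Z + cond_Ent (St n) (p n) (\<lambda>s. snd (fst s)) (\<lambda>s. (fst (fst s), Z s))"
proof -
  have "Ent (St n) (p n) (\<lambda>s. (snd (fst s), fst (fst s), Z s)) = Ent (St n) (p n) (\<lambda>s. (fst s, Z s))"
    by (rule Ent_fun_cong) auto
  then show ?thesis unfolding cond_Ent_def by simp
qed

lemma cond_Ent_messages2:
  "cond_Ent (St n) (p n) fst Z =
    cond_Ent (St n) (p n) (\<lambda>s. snd (fst s)) Z + cond_Ent (St n) (p n) (\<lambda>s. fst (fst s)) (\<lambda>s. (snd (fst s), Z s))"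
proof -
  have "Ent (St n) (p n) (\<lambda>s. (fst (fst s), snd (fst s), Z s)) = Ent (St n) (p n) (\<lambda>s. (fst s, Z s))"
    by (rule Ent_fun_cong) auto
  then show ?thesis unfolding cond_Ent_def by simp
qed

lemma cond_Ent_message1_le: "cond_Ent (St n) (p n) (\<lambda>s. fst (fst s)) Z \<le> log 2 M1"
proof -
  have "cond_Ent (St n) (p n) (\<lambda>s. fst (fst s)) Z \<le> log 2 (card {1..M1})"
    by (rule W.cond_Ent_le_log_card[OF _ _ sum_p]) (auto simp: St_def)
  then show ?thesis by simp
qed

lemma cond_Ent_message2_le: "cond_Ent (St n) (p n) (\<lambda>s. snd (fst s)) Z \<le> log 2 M2"
proof -
  have "cond_Ent (St n) (p n) (\<lambda>s. snd (fst s)) Z \<le> log 2 (card {1..M2})"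
    by (rule W.cond_Ent_le_log_card[OF _ _ sum_p]) (auto simp: St_def)
  then show ?thesis by simp
qed

text \<open>\<open>Z\<close> reveals what both receivers see, so both decoders can be run on it. The
  constant 2 is one bit of Fano's inequality per message.\<close>

lemma cond_Ent_both:
  assumes code: "is_code P n M1 M2 e1 e2 f1 f2 g1 g2"
    and Y1: "\<And>s s'. Z s = Z s' \<Longrightarrow> map (\<lambda>(y1, y2, z1, z2). y1) (snd s) = map (\<lambda>(y1, y2, z1, z2). y1) (snd s')"
    and Y2: "\<And>s s'. Z s = Z s' \<Longrightarrow> map (\<lambda>(y1, y2, z1, z2). y2) (snd s) = map (\<lambda>(y1, y2, z1, z2). y2) (snd s')"
  shows "cond_Ent (St n) (p n) fst Z \<le> 2 + e1 * log 2 M1 + e2 * log 2 M2"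
proof -
  have "cond_Ent (St n) (p n) (\<lambda>s. fst (fst s)) Z \<le> 1 + e1 * log 2 M1"
    by (rule order.trans[OF W.cond_Ent_mono fano1[OF code]]) (rule Y1)
  moreover have "cond_Ent (St n) (p n) (\<lambda>s. snd (fst s)) (\<lambda>s. (fst (fst s), Z s)) \<le> 1 + e2 * log 2 M2"
    by (rule order.trans[OF W.cond_Ent_mono fano2[OF code]]) (rule Y2, auto)
  ultimately show ?thesis unfolding cond_Ent_messages1 by linarith
qed

end

section \<open>Single-letter functionals\<close>

lemma cmi_cong:
  assumes "\<And>s s'. s \<in> S \<Longrightarrow> s' \<in> S \<Longrightarrow> X s = X s' \<longleftrightarrow> X' s = X' s'"
    and "\<And>s s'. s \<in> S \<Longrightarrow> s' \<in> S \<Longrightarrow> Y s = Y s' \<longleftrightarrow> Y' s = Y' s'"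
    and "\<And>s s'. s \<in> S \<Longrightarrow> s' \<in> S \<Longrightarrow> Z s = Z s' \<longleftrightarrow> Z' s = Z' s'"
  shows "cmi S a X Y Z = cmi S a X' Y' Z'"
proof -
  have "Ent S a Z = Ent S a Z'" "Ent S a (\<lambda>s. (Y s, Z s)) = Ent S a (\<lambda>s. (Y' s, Z' s))"
    "Ent S a (\<lambda>s. (X s, Z s)) = Ent S a (\<lambda>s. (X' s, Z' s))"
    "Ent S a (\<lambda>s. (Y s, X s, Z s)) = Ent S a (\<lambda>s. (Y' s, X' s, Z' s))"
    by (intro Ent_fun_cong; use assms in \<open>simp; blast\<close>)+
  then show ?thesis unfolding cmi_def cond_Ent_def by simp
qed

text \<open>The information between both inputs and the observation \<open>c\<close>. At a single
  slice it is one term of a bound conditioned on \<open>T\<close>; at the sum of all slices it is an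
  unconditioned bound.\<close>

definition rate :: "('x1::finite, 'x2::finite, 'y1::finite, 'y2::finite, 'f1::finite, 'f2::finite) icgf \<Rightarrow>
    ('y1 \<times> 'y2 \<times> 'f1 \<times> 'f2 \<Rightarrow> 'c) \<Rightarrow> ('x1 \<times> 'x2 \<Rightarrow> real) \<Rightarrow> real" where
  "rate P c b = cmi UNIV (joint_weight P b) (\<lambda>(x1, x2, u). (x1, x2)) (\<lambda>(x1, x2, u). c u) (\<lambda>_. ())"

definition info1 :: "('x1::finite, 'x2::finite, 'y1::finite, 'y2::finite, 'f1::finite, 'f2::finite) icgf \<Rightarrow>
    ('x1 \<times> 'x2 \<Rightarrow> real) \<Rightarrow> real" where
  "info1 P b = cmi UNIV (joint_weight P b) (\<lambda>(x1, x2, u). x1)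
     (\<lambda>(x1, x2, y1, y2, z1, z2). (y1, y2, z2)) (\<lambda>(x1, x2, u). x2)"

definition info2 :: "('x1::finite, 'x2::finite, 'y1::finite, 'y2::finite, 'f1::finite, 'f2::finite) icgf \<Rightarrow>
    ('x1 \<times> 'x2 \<Rightarrow> real) \<Rightarrow> real" where
  "info2 P b = cmi UNIV (joint_weight P b) (\<lambda>(x1, x2, u). x2)
     (\<lambda>(x1, x2, y1, y2, z1, z2). (y1, y2, z1)) (\<lambda>(x1, x2, u). x1)"

text \<open>The dependence balance bound says that the sum of this over the labels is
  nonnegative.\<close>

definition balance :: "('x1::finite, 'x2::finite, 'y1::finite, 'y2::finite, 'f1::finite, 'f2::finite) icgf \<Rightarrow>
    ('x1 \<times> 'x2 \<Rightarrow> real) \<Rightarrow> real" where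
  "balance P b =
     cmi UNIV (joint_weight P b) (\<lambda>(x1, x2, u). x1) (\<lambda>(x1, x2, u). x2) (\<lambda>(x1, x2, y1, y2, z1, z2). (z1, z2))
     - cmi UNIV (joint_weight P b) (\<lambda>(x1, x2, u). x1) (\<lambda>(x1, x2, u). x2) (\<lambda>_. ())"

lemmas functional_defs = rate_def info1_def info2_def balance_def

lemma joint_weight_scale: "joint_weight P (\<lambda>x. c * b x) = (\<lambda>r. c * joint_weight P b r)"
  by (auto simp: joint_weight_def)

lemma joint_weight_nonneg: "(\<And>x. 0 \<le> b x) \<Longrightarrow> 0 \<le> joint_weight P b r"
  by (auto simp: joint_weight_def split: prod.splits)

lemma functionals_scale:
  assumes "0 \<le> k" "\<And>x. 0 \<le> b x"
  shows "rate P c (\<lambda>x. k * b x) = k * rate P c b" "info1 P (\<lambda>x. k * b x) = k * info1 P b"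
    "info2 P (\<lambda>x. k * b x) = k * info2 P b" "balance P (\<lambda>x. k * b x) = k * balance P b"
  unfolding functional_defs joint_weight_scale
  by (simp_all add: cmi_scale joint_weight_nonneg assms right_diff_distrib)

text \<open>Concavity of mutual information in the input law, in homogeneous form. Take the index
  \<open>i\<close> as a further variable: removing it from the condition raises the entropy of the
  observation, and once the inputs are given it has no influence.\<close>

lemma rate_superadditive:
  fixes P :: "('x1::finite, 'x2::finite, 'y1::finite, 'y2::finite, 'f1::finite, 'f2::finite) icgf"
  assumes I: "finite I" and b: "\<And>i x. i \<in> I \<Longrightarrow> 0 \<le> b i x"
  shows "(\<Sum>i\<in>I. rate P c (b i)) \<le> rate P c (\<lambda>x. \<Sum>i\<in>I. b i x)"
proof -
  let ?S = "I \<times> (UNIV :: ('x1 \<times> 'x2) set)"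
  let ?a = "\<lambda>(i, x). b i x"
  let ?k = "\<lambda>s u. pmf (P (fst (snd s)) (snd (snd s))) u"
  let ?w = "\<lambda>(s, u). ?a s * ?k s u"
  let ?T = "?S \<times> (UNIV :: ('y1 \<times> 'y2 \<times> 'f1 \<times> 'f2) set)"
  interpret S: weighted_set ?S ?a by unfold_locales (use I b in auto)
  interpret T: weighted_set ?T ?w by (rule S.weighted_set_kernel) auto
  let ?H = "\<lambda>Z. cond_Ent ?T ?w (\<lambda>(s, u). c u) Z"
  have "rate P c (\<lambda>x. \<Sum>i\<in>I. b i x) =
      cmi ?T ?w (\<lambda>r. (\<lambda>(x1, x2, u). (x1, x2)) ((\<lambda>((i, x1, x2), u). (x1, x2, u)) r))
        (\<lambda>r. (\<lambda>(x1, x2, u). c u) ((\<lambda>((i, x1, x2), u). (x1, x2, u)) r)) (\<lambda>r. ())"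
    unfolding rate_def
  proof (rule cmi_push)
    fix v :: "'x1 \<times> 'x2 \<times> 'y1 \<times> 'y2 \<times> 'f1 \<times> 'f2"
    obtain x1 x2 u where v: "v = (x1, x2, u)" by (cases v) auto
    have "{r \<in> ?T. (\<lambda>((i, x1, x2), u). (x1, x2, u)) r = v} = (\<lambda>i. ((i, x1, x2), u)) ` I"
      by (auto simp: v image_iff)
    then have "marg ?T ?w (\<lambda>((i, x1, x2), u). (x1, x2, u)) v = sum ?w ((\<lambda>i. ((i, x1, x2), u)) ` I)"
      unfolding marg_def by (simp only:)
    also have "\<dots> = (\<Sum>i\<in>I. b i (x1, x2) * pmf (P x1 x2) u)"
      by (subst sum.reindex) (auto simp: inj_on_def)
    finally show "joint_weight P (\<lambda>x. \<Sum>i\<in>I. b i x) v = marg ?T ?w (\<lambda>((i, x1, x2), u). (x1, x2, u)) v"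
      by (simp add: v joint_weight_def sum_distrib_right)
  qed (use I in auto)
  also have "\<dots> = cmi ?T ?w (\<lambda>(s, u). snd s) (\<lambda>(s, u). c u) (\<lambda>(s, u). ())"
    by (rule cmi_cong) auto
  finally have total: "rate P c (\<lambda>x. \<Sum>i\<in>I. b i x) = cmi ?T ?w (\<lambda>(s, u). snd s) (\<lambda>(s, u). c u) (\<lambda>(s, u). ())" .
  have "(\<Sum>i\<in>I. rate P c (b i)) = cmi (I \<times> UNIV) (\<lambda>(i, r). joint_weight P (b i) r)
      (\<lambda>(i, r). (\<lambda>(x1, x2, u). (x1, x2)) r) (\<lambda>(i, r). (\<lambda>(x1, x2, u). c u) r) (\<lambda>(i, r). ((), i))"
    unfolding rate_def by (subst cmi_split) (use I in auto)
  also have "\<dots> = cmi ?T ?w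
      (\<lambda>r. (\<lambda>(i, r). (\<lambda>(x1, x2, u). (x1, x2)) r) ((\<lambda>((i, x1, x2), u). (i, x1, x2, u)) r))
      (\<lambda>r. (\<lambda>(i, r). (\<lambda>(x1, x2, u). c u) r) ((\<lambda>((i, x1, x2), u). (i, x1, x2, u)) r))
      (\<lambda>r. (\<lambda>(i, r). ((), i)) ((\<lambda>((i, x1, x2), u). (i, x1, x2, u)) r))"
  proof (rule cmi_push)
    fix v assume v': "v \<in> I \<times> (UNIV :: ('x1 \<times> 'x2 \<times> 'y1 \<times> 'y2 \<times> 'f1 \<times> 'f2) set)"
    obtain i x1 x2 u where v: "v = (i, x1, x2, u)" by (cases v) auto
    have "{r \<in> ?T. (\<lambda>((i, x1, x2), u). (i, x1, x2, u)) r = v} = {((i, x1, x2), u)}"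
      using v' by (auto simp: v)
    then show "(\<lambda>(i, r). joint_weight P (b i) r) v = marg ?T ?w (\<lambda>((i, x1, x2), u). (i, x1, x2, u)) v"
      unfolding marg_def by (simp add: v joint_weight_def)
  qed (use I in auto)
  also have "\<dots> = cmi ?T ?w (\<lambda>(s, u). snd s) (\<lambda>(s, u). c u) (\<lambda>(s, u). fst s)"
    by (rule cmi_cong) auto
  finally have parts: "(\<Sum>i\<in>I. rate P c (b i)) = cmi ?T ?w (\<lambda>(s, u). snd s) (\<lambda>(s, u). c u) (\<lambda>(s, u). fst s)" .
  have "?H (\<lambda>(s, u). fst s) \<le> ?H (\<lambda>(s, u). ())"
    by (rule T.cond_Ent_mono) auto
  moreover have "?H (\<lambda>(s, u). (snd s, fst s)) = ?H (\<lambda>(s, u). (snd s, ()))"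
    by (rule trans[OF S.cond_Ent_kernel S.cond_Ent_kernel[symmetric]]) (simp_all add: sum_pmf_eq_1)
  moreover have "?H (\<lambda>r. (case r of (s, u) \<Rightarrow> snd s, case r of (s, u) \<Rightarrow> fst s)) = ?H (\<lambda>(s, u). (snd s, fst s))"
    "?H (\<lambda>r. (case r of (s, u) \<Rightarrow> snd s, case r of (s, u) \<Rightarrow> ())) = ?H (\<lambda>(s, u). (snd s, ()))"
    by (rule T.cond_Ent_cong; auto)+
  ultimately show ?thesis unfolding total parts cmi_def by linarith
qed

subsection \<open>Feedback letters that depend on one input only\<close>

text \<open>Given \<open>X2\<close>, the feedback \<open>Y_F_1\<close> is independent of
  \<open>X1\<close> and of the other outputs, so it can be deleted from the observation.\<close>

lemma info1_eq:
  fixes P :: "('x1::finite, 'x2::finite, 'y1::finite, 'y2::finite, 'f1::finite, 'f2::finite) icgf"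
  assumes P: "\<And>x1 x2 y1 y2 z1 z2. pmf (P x1 x2) (y1, y2, z1, z2) =
      pmf (Q x1 x2) (y1, y2) * pmf (F1 x2) z1 * pmf (F2 x1) z2"
    and b: "\<And>x. 0 \<le> b x"
  shows "cmi UNIV (joint_weight P b) (\<lambda>(x1, x2, u). x1) (\<lambda>(x1, x2, u). u) (\<lambda>(x1, x2, u). x2) = info1 P b"
proof -
  \<comment> \<open>The state \<open>s\<close> holds all coordinates but \<open>z1\<close>, which is
    then generated from \<open>x2\<close> by the kernel \<open>?k\<close>;
    \<open>cmi_drop_kernel\<close> removes that last letter.\<close>
  let ?a = "\<lambda>(x1, x2, y1, y2, z2). b (x1, x2) * pmf (Q x1 x2) (y1, y2) * pmf (F2 x1) z2"
  let ?k = "\<lambda>s z. pmf (F1 (fst (snd s))) z"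
  let ?w = "\<lambda>(s, z). ?a s * ?k s z"
  let ?T = "(UNIV :: ('x1 \<times> 'x2 \<times> 'y1 \<times> 'y2 \<times> 'f2) set) \<times> (UNIV :: 'f1 set)"
  let ?g = "\<lambda>((x1, x2, y1, y2, z2), z1). (x1, x2, y1, y2, z1, z2)"
  interpret S: weighted_set UNIV ?a by unfold_locales (use b in auto)
  have push: "cmi UNIV (joint_weight P b) X Y Z = cmi ?T ?w (\<lambda>r. X (?g r)) (\<lambda>r. Y (?g r)) (\<lambda>r. Z (?g r))"
    for X :: "_ \<Rightarrow> 'u" and Y :: "_ \<Rightarrow> 'v" and Z :: "_ \<Rightarrow> 'w"
  proof (rule cmi_push)
    fix v :: "'x1 \<times> 'x2 \<times> 'y1 \<times> 'y2 \<times> 'f1 \<times> 'f2"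
    obtain x1 x2 y1 y2 z1 z2 where v: "v = (x1, x2, y1, y2, z1, z2)" by (cases v) auto
    have "{r \<in> ?T. ?g r = v} = {((x1, x2, y1, y2, z2), z1)}" by (auto simp: v)
    then show "joint_weight P b v = marg ?T ?w ?g v"
      unfolding marg_def by (simp add: v joint_weight_def P)
  qed auto
  have "cmi UNIV (joint_weight P b) (\<lambda>(x1, x2, u). x1) (\<lambda>(x1, x2, u). u) (\<lambda>(x1, x2, u). x2) =
      cmi ?T ?w (\<lambda>(s, z). fst s) (\<lambda>(s, z). (snd (snd s), z)) (\<lambda>(s, z). fst (snd s))"
    unfolding push by (rule cmi_cong) auto
  also have "\<dots> = cmi ?T ?w (\<lambda>(s, z). fst s) (\<lambda>(s, z). snd (snd s)) (\<lambda>(s, z). fst (snd s))"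
    by (rule S.cmi_drop_kernel) (simp_all add: sum_pmf_eq_1)
  also have "\<dots> = info1 P b"
    unfolding info1_def push by (rule cmi_cong) auto
  finally show ?thesis .
qed

lemma info2_eq:
  fixes P :: "('x1::finite, 'x2::finite, 'y1::finite, 'y2::finite, 'f1::finite, 'f2::finite) icgf"
  assumes P: "\<And>x1 x2 y1 y2 z1 z2. pmf (P x1 x2) (y1, y2, z1, z2) =
      pmf (Q x1 x2) (y1, y2) * pmf (F1 x2) z1 * pmf (F2 x1) z2"
    and b: "\<And>x. 0 \<le> b x"
  shows "cmi UNIV (joint_weight P b) (\<lambda>(x1, x2, u). x2) (\<lambda>(x1, x2, u). u) (\<lambda>(x1, x2, u). x1) = info2 P b"
proof -
  let ?a = "\<lambda>(x1, x2, y1, y2, z1). b (x1, x2) * pmf (Q x1 x2) (y1, y2) * pmf (F1 x2) z1"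
  let ?k = "\<lambda>s z. pmf (F2 (fst s)) z"
  let ?w = "\<lambda>(s, z). ?a s * ?k s z"
  let ?T = "(UNIV :: ('x1 \<times> 'x2 \<times> 'y1 \<times> 'y2 \<times> 'f1) set) \<times> (UNIV :: 'f2 set)"
  let ?g = "\<lambda>((x1, x2, y1, y2, z1), z2). (x1, x2, y1, y2, z1, z2)"
  interpret S: weighted_set UNIV ?a by unfold_locales (use b in auto)
  have push: "cmi UNIV (joint_weight P b) X Y Z = cmi ?T ?w (\<lambda>r. X (?g r)) (\<lambda>r. Y (?g r)) (\<lambda>r. Z (?g r))"
    for X :: "_ \<Rightarrow> 'u" and Y :: "_ \<Rightarrow> 'v" and Z :: "_ \<Rightarrow> 'w"
  proof (rule cmi_push)
    fix v :: "'x1 \<times> 'x2 \<times> 'y1 \<times> 'y2 \<times> 'f1 \<times> 'f2"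
    obtain x1 x2 y1 y2 z1 z2 where v: "v = (x1, x2, y1, y2, z1, z2)" by (cases v) auto
    have "{r \<in> ?T. ?g r = v} = {((x1, x2, y1, y2, z1), z2)}" by (auto simp: v)
    then show "joint_weight P b v = marg ?T ?w ?g v"
      unfolding marg_def by (simp add: v joint_weight_def P)
  qed auto
  have "cmi UNIV (joint_weight P b) (\<lambda>(x1, x2, u). x2) (\<lambda>(x1, x2, u). u) (\<lambda>(x1, x2, u). x1) =
      cmi ?T ?w (\<lambda>(s, z). fst (snd s)) (\<lambda>(s, z). (snd (snd s), z)) (\<lambda>(s, z). fst s)"
    unfolding push by (rule cmi_cong) auto
  also have "\<dots> = cmi ?T ?w (\<lambda>(s, z). fst (snd s)) (\<lambda>(s, z). snd (snd s)) (\<lambda>(s, z). fst s)"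
    by (rule S.cmi_drop_kernel) (simp_all add: sum_pmf_eq_1)
  also have "\<dots> = info2 P b"
    unfolding info2_def push by (rule cmi_cong) auto
  finally show ?thesis .
qed

text \<open>The inequalities of the region in terms of slices. The sum rate \<open>r12\<close> is a
  parameter of its own, so that each of the three bounds can carry its own slack before the
  limit.\<close>

definition outer_bounds :: "('x1::finite, 'x2::finite, 'y1::finite, 'y2::finite, 'f1::finite, 'f2::finite) icgf \<Rightarrow>
    'l set \<Rightarrow> ('l \<Rightarrow> 'x1 \<times> 'x2 \<Rightarrow> real) \<Rightarrow> real \<Rightarrow> real \<Rightarrow> real \<Rightarrow> bool" where
  "outer_bounds P L b r1 r2 r12 \<longleftrightarrow> finite L \<and> (\<forall>l x. 0 \<le> b l x) \<and> (\<Sum>l\<in>L. \<Sum>x\<in>UNIV. b l x) = 1 \<and>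
     r1 \<le> rate P (\<lambda>(y1, y2, z1, z2). y1) (\<lambda>x. \<Sum>l\<in>L. b l x) \<and>
     r2 \<le> rate P (\<lambda>(y1, y2, z1, z2). y2) (\<lambda>x. \<Sum>l\<in>L. b l x) \<and>
     r12 \<le> rate P (\<lambda>(y1, y2, z1, z2). (y1, y2)) (\<lambda>x. \<Sum>l\<in>L. b l x) \<and>
     r1 \<le> (\<Sum>l\<in>L. info1 P (b l)) \<and> r2 \<le> (\<Sum>l\<in>L. info2 P (b l)) \<and>
     r12 \<le> (\<Sum>l\<in>L. rate P (\<lambda>u. u) (b l)) \<and> 0 \<le> (\<Sum>l\<in>L. balance P (b l))"

section \<open>Single-letter bounds for a code\<close>

context feedback_code
begin

lemma total_rate_le:
  "log 2 M1 + log 2 M2 - cond_Ent (St n) (p n) fst (\<lambda>s. map c (snd s))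
    \<le> (\<Sum>i<n. rate P c (\<lambda>x. \<Sum>t\<in>FB ` St i. slice i t x))"
proof -
  have "cmi (Tr i) (q i) (\<lambda>(s, u). (X1 s, X2 s)) (\<lambda>(s, u). c u) (\<lambda>(s, u). ()) =
      rate P c (\<lambda>x. \<Sum>t\<in>FB ` St i. slice i t x)" for i
    unfolding rate_def
    using cmi_unconditioned[of i "\<lambda>(x1, x2, u). (x1, x2)" "\<lambda>(x1, x2, u). c u"]
    by (simp add: case_prod_unfold)
  then show ?thesis using sum_total[of c "\<lambda>_. ()" n] by simp
qed

lemma slice_rate_le:
  "log 2 M1 + log 2 M2 - cond_Ent (St n) (p n) fst snd
    \<le> (\<Sum>i<n. \<Sum>t\<in>FB ` St i. rate P (\<lambda>u. u) (slice i t))"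
proof -
  have "cmi (Tr i) (q i) (\<lambda>(s, u). (X1 s, X2 s)) (\<lambda>(s, u). u) (\<lambda>(s, u). FB s) =
      (\<Sum>t\<in>FB ` St i. rate P (\<lambda>u. u) (slice i t))" for i
  proof -
    have "cmi (Tr i) (q i) (\<lambda>(s, u). (X1 s, X2 s)) (\<lambda>(s, u). u) (\<lambda>(s, u). FB s) =
        cmi (Tr i) (q i) (\<lambda>(s, u). (X1 s, X2 s)) (\<lambda>(s, u). u) (\<lambda>(s, u). ((), FB s))"
      by (rule cmi_cong) auto
    then show ?thesis
      unfolding rate_def
      using cmi_slices[of i "\<lambda>(x1, x2, u). (x1, x2)" "\<lambda>(x1, x2, u). u" "\<lambda>_. ()"] by simp
  qed
  moreover have "log 2 M1 + log 2 M2 - cond_Ent (St n) (p n) fst (\<lambda>s. map (\<lambda>u. u) (snd s))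
      \<le> (\<Sum>i<n. cmi (Tr i) (q i) (\<lambda>(s, u). (X1 s, X2 s)) (\<lambda>(s, u). u) (\<lambda>(s, u). FB s))"
    by (rule sum_total, rule FB_eq) simp
  ultimately show ?thesis by simp
qed

lemma slice_balance_nonneg: "0 \<le> (\<Sum>i<n. \<Sum>t\<in>FB ` St i. balance P (slice i t))"
proof -
  have "cmi (Tr i) (q i) (\<lambda>(s, u). X1 s) (\<lambda>(s, u). X2 s)
      (\<lambda>r. (case r of (s, (y1, y2, z1, z2)) \<Rightarrow> (z1, z2), case r of (s, u) \<Rightarrow> FB s))
    - cmi (Tr i) (q i) (\<lambda>(s, u). X1 s) (\<lambda>(s, u). X2 s) (\<lambda>(s, u). FB s) =
      (\<Sum>t\<in>FB ` St i. balance P (slice i t))" for i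
  proof -
    have "cmi (Tr i) (q i) (\<lambda>(s, u). X1 s) (\<lambda>(s, u). X2 s) (\<lambda>(s, u). FB s) =
        cmi (Tr i) (q i) (\<lambda>(s, u). X1 s) (\<lambda>(s, u). X2 s) (\<lambda>(s, u). ((), FB s))"
      by (rule cmi_cong) auto
    moreover have "cmi (Tr i) (q i) (\<lambda>(s, u). X1 s) (\<lambda>(s, u). X2 s)
        (\<lambda>r. (case r of (s, (y1, y2, z1, z2)) \<Rightarrow> (z1, z2), case r of (s, u) \<Rightarrow> FB s)) =
        cmi (Tr i) (q i) (\<lambda>(s, u). X1 s) (\<lambda>(s, u). X2 s)
        (\<lambda>(s, u). ((\<lambda>(x1, x2, y1, y2, z1, z2). (z1, z2)) (X1 s, X2 s, u), FB s))"
      by (rule cmi_cong) auto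
    ultimately show ?thesis
      unfolding balance_def sum_subtractf
      using cmi_slices[of i "\<lambda>(x1, x2, u). x1" "\<lambda>(x1, x2, u). x2" "\<lambda>_. ()"]
        cmi_slices[of i "\<lambda>(x1, x2, u). x1" "\<lambda>(x1, x2, u). x2" "\<lambda>(x1, x2, y1, y2, z1, z2). (z1, z2)"]
      by simp
  qed
  then show ?thesis using sum_dependence[of n] by simp
qed

text \<open>The bounds conditioned on \<open>T\<close> are sums over labels and scale exactly by
  \<open>1 / n\<close>. Those without \<open>T\<close> pass from the average over the times to the
  averaged input law by \<open>rate_superadditive\<close>. The constants 1 and 2 come from Fano's
  inequality.\<close>

lemma code_outer_bounds:
  assumes P: "\<And>x1 x2 y1 y2 z1 z2. pmf (P x1 x2) (y1, y2, z1, z2) =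
      pmf (Q x1 x2) (y1, y2) * pmf (F1 x2) z1 * pmf (F2 x1) z2"
    and code: "is_code P n M1 M2 e1 e2 f1 f2 g1 g2" and n: "0 < n"
  shows "outer_bounds P (SIGMA i:{..<n}. FB ` St i) (\<lambda>(i, t) x. 1 / n * slice i t x)
    (((1 - e1) * log 2 M1 - 1) / n) (((1 - e2) * log 2 M2 - 1) / n)
    (((1 - e1) * log 2 M1 + (1 - e2) * log 2 M2 - 2) / n)"
proof -
  let ?L = "SIGMA i:{..<n}. FB ` St i"
  let ?b = "\<lambda>(i, t) x. 1 / n * slice i t x"
  have fin: "finite (FB ` St i)" for i using finite_St by blast
  have reindex: "(\<Sum>l\<in>?L. \<phi> (?b l)) = (\<Sum>i<n. \<Sum>t\<in>FB ` St i. \<phi> (\<lambda>x. 1 / n * slice i t x))" for \<phi> :: "_ \<Rightarrow> real"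
    by (subst sum.Sigma) (auto simp: fin intro!: sum.cong)
  have avg: "(\<Sum>i<n. rate P c (\<lambda>x. \<Sum>t\<in>FB ` St i. slice i t x)) / n \<le> rate P c (\<lambda>x. \<Sum>l\<in>?L. ?b l x)"
    for c :: "_ \<Rightarrow> 'c"
  proof -
    have "(\<Sum>i<n. rate P c (\<lambda>x. \<Sum>t\<in>FB ` St i. slice i t x)) / n =
        (\<Sum>i<n. rate P c (\<lambda>x. 1 / n * (\<Sum>t\<in>FB ` St i. slice i t x)))"
      by (subst functionals_scale) (auto simp: sum_divide_distrib intro!: sum_nonneg slice_nonneg divide_nonneg_nonneg)
    also have "\<dots> \<le> rate P c (\<lambda>x. \<Sum>i<n. 1 / n * (\<Sum>t\<in>FB ` St i. slice i t x))"
      by (rule rate_superadditive) (auto intro!: sum_nonneg slice_nonneg divide_nonneg_nonneg)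
    also have "(\<lambda>x. \<Sum>i<n. 1 / n * (\<Sum>t\<in>FB ` St i. slice i t x)) = (\<lambda>x. \<Sum>l\<in>?L. ?b l x)"
      unfolding sum_distrib_left by (subst sum.Sigma) (auto simp: fin intro!: sum.cong)
    finally show ?thesis .
  qed
  have rate_le: "r / n \<le> rate P c (\<lambda>x. \<Sum>l\<in>?L. ?b l x)"
    if "r \<le> log 2 M1 + log 2 M2 - cond_Ent (St n) (p n) fst (\<lambda>s. map c (snd s))" for r and c :: "_ \<Rightarrow> 'c"
    by (rule order.trans[OF divide_right_mono avg]) (use that total_rate_le[of n c] in auto)
  have total: "(\<Sum>l\<in>?L. \<Sum>x\<in>UNIV. ?b l x) = 1"
    unfolding reindex[of "\<lambda>b. \<Sum>x\<in>UNIV. b x"] sum_distrib_left[symmetric] sum_slice_total using n by simp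
  have "0 \<le> 1 / real n" by simp
  note scale = functionals_scale[OF this slice_nonneg]
  \<comment> \<open>Receiver 1 alone: Fano bounds the uncertainty about message 1, and that about
    message 2 is at most the \<open>log 2 M2\<close> on the right.\<close>
  have 1: "(1 - e1) * log 2 M1 - 1 \<le>
      log 2 M1 + log 2 M2 - cond_Ent (St n) (p n) fst (\<lambda>s. map (\<lambda>(y1, y2, z1, z2). y1) (snd s))"
    unfolding cond_Ent_messages1
    using fano1[OF code]
      cond_Ent_message2_le[of n "\<lambda>s. (fst (fst s), map (\<lambda>(y1, y2, z1, z2). y1) (snd s))"]
    unfolding left_diff_distrib by linarith
  have 2: "(1 - e2) * log 2 M2 - 1 \<le>
      log 2 M1 + log 2 M2 - cond_Ent (St n) (p n) fst (\<lambda>s. map (\<lambda>(y1, y2, z1, z2). y2) (snd s))"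
    unfolding cond_Ent_messages2
    using fano2[OF code]
      cond_Ent_message1_le[of n "\<lambda>s. (snd (fst s), map (\<lambda>(y1, y2, z1, z2). y2) (snd s))"]
    unfolding left_diff_distrib by linarith
  have 3: "(1 - e1) * log 2 M1 + (1 - e2) * log 2 M2 - 2 \<le>
      log 2 M1 + log 2 M2 - cond_Ent (St n) (p n) fst Z"
    if "\<And>s s'. Z s = Z s' \<Longrightarrow> map (\<lambda>(y1, y2, z1, z2). y1) (snd s) = map (\<lambda>(y1, y2, z1, z2). y1) (snd s')"
      "\<And>s s'. Z s = Z s' \<Longrightarrow> map (\<lambda>(y1, y2, z1, z2). y2) (snd s) = map (\<lambda>(y1, y2, z1, z2). y2) (snd s')"
    for Z :: "_ \<Rightarrow> 'c"
    using cond_Ent_both[where Z = Z, OF code that] by (simp add: left_diff_distrib)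
  have Y12: "map (\<lambda>(y1, y2, z1, z2). y1) h = map fst (map (\<lambda>(y1, y2, z1, z2). (y1, y2)) h)"
    "map (\<lambda>(y1, y2, z1, z2). y2) h = map snd (map (\<lambda>(y1, y2, z1, z2). (y1, y2)) h)"
    for h :: "('y1 \<times> 'y2 \<times> 'f1 \<times> 'f2) list"
    by auto
  have i1: "((1 - e1) * log 2 M1 - 1) / n \<le> (\<Sum>l\<in>?L. info1 P (?b l))"
  proof -
    have "cmi (Tr i) (q i) (\<lambda>(s, u). X1 s) (\<lambda>(s, u). u) (\<lambda>(s, u). (X2 s, FB s)) =
        (\<Sum>t\<in>FB ` St i. info1 P (slice i t))" for i
      using cmi_slices[of i "\<lambda>(x1, x2, u). x1" "\<lambda>(x1, x2, u). u" "\<lambda>(x1, x2, u). x2"]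
      by (simp add: info1_eq[OF P slice_nonneg])
    then have "log 2 M1 - cond_Ent (St n) (p n) (\<lambda>s. fst (fst s)) (\<lambda>s. (snd (fst s), snd s))
        \<le> (\<Sum>i<n. \<Sum>t\<in>FB ` St i. info1 P (slice i t))"
      using sum_user1[of n] by simp
    moreover have "cond_Ent (St n) (p n) (\<lambda>s. fst (fst s)) (\<lambda>s. (snd (fst s), snd s)) \<le> 1 + e1 * log 2 M1"
      by (rule order.trans[OF W.cond_Ent_mono fano1[OF code]]) auto
    ultimately have "(1 - e1) * log 2 M1 - 1 \<le> (\<Sum>i<n. \<Sum>t\<in>FB ` St i. info1 P (slice i t))"
      by (simp add: left_diff_distrib)
    then show ?thesis
      unfolding reindex[of "info1 P"] scale sum_distrib_left[symmetric]
      using n by (simp add: divide_right_mono)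
  qed
  have i2: "((1 - e2) * log 2 M2 - 1) / n \<le> (\<Sum>l\<in>?L. info2 P (?b l))"
  proof -
    have "cmi (Tr i) (q i) (\<lambda>(s, u). X2 s) (\<lambda>(s, u). u) (\<lambda>(s, u). (X1 s, FB s)) =
        (\<Sum>t\<in>FB ` St i. info2 P (slice i t))" for i
      using cmi_slices[of i "\<lambda>(x1, x2, u). x2" "\<lambda>(x1, x2, u). u" "\<lambda>(x1, x2, u). x1"]
      by (simp add: info2_eq[OF P slice_nonneg])
    then have "log 2 M2 - cond_Ent (St n) (p n) (\<lambda>s. snd (fst s)) (\<lambda>s. (fst (fst s), snd s))
        \<le> (\<Sum>i<n. \<Sum>t\<in>FB ` St i. info2 P (slice i t))"
      using sum_user2[of n] by simp
    moreover have "cond_Ent (St n) (p n) (\<lambda>s. snd (fst s)) (\<lambda>s. (fst (fst s), snd s)) \<le> 1 + e2 * log 2 M2"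
      by (rule order.trans[OF W.cond_Ent_mono fano2[OF code]]) auto
    ultimately have "(1 - e2) * log 2 M2 - 1 \<le> (\<Sum>i<n. \<Sum>t\<in>FB ` St i. info2 P (slice i t))"
      by (simp add: left_diff_distrib)
    then show ?thesis
      unfolding reindex[of "info2 P"] scale sum_distrib_left[symmetric]
      using n by (simp add: divide_right_mono)
  qed
  have i12: "((1 - e1) * log 2 M1 + (1 - e2) * log 2 M2 - 2) / n \<le> (\<Sum>l\<in>?L. rate P (\<lambda>u. u) (?b l))"
  proof -
    have "(1 - e1) * log 2 M1 + (1 - e2) * log 2 M2 - 2 \<le> (\<Sum>i<n. \<Sum>t\<in>FB ` St i. rate P (\<lambda>u. u) (slice i t))"
      by (rule order.trans[OF 3 slice_rate_le]) auto
    then show ?thesis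
      unfolding reindex[of "rate P (\<lambda>u. u)"] scale sum_distrib_left[symmetric]
      using n by (simp add: divide_right_mono)
  qed
  have bal: "0 \<le> (\<Sum>l\<in>?L. balance P (?b l))"
    unfolding reindex[of "balance P"] scale sum_distrib_left[symmetric]
    using slice_balance_nonneg[of n] by simp
  have r12: "((1 - e1) * log 2 M1 + (1 - e2) * log 2 M2 - 2) / n
      \<le> rate P (\<lambda>(y1, y2, z1, z2). (y1, y2)) (\<lambda>x. \<Sum>l\<in>?L. ?b l x)"
    by (rule rate_le, rule 3) (simp_all only: Y12)
  show ?thesis
    unfolding outer_bounds_def
    by (intro conjI rate_le[OF 1] rate_le[OF 2] r12 total i1 i2 i12 bal) (auto simp: fin slice_nonneg)
qed

end

section \<open>Reducing the number of labels\<close>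

text \<open>Gaussian elimination, one equation per induction step: the pivot \<open>l0\<close> of
  equation \<open>k\<close> is eliminated from the other equations, and its unknown is recovered by
  back substitution in \<open>d'\<close>.\<close>

lemma homogeneous_system_nontrivial:
  fixes g :: "'k \<Rightarrow> 'l \<Rightarrow> real"
  assumes "finite K" "finite L" "card K < card L"
  shows "\<exists>d. (\<exists>l\<in>L. d l \<noteq> 0) \<and> (\<forall>k\<in>K. (\<Sum>l\<in>L. d l * g k l) = 0)"
  using assms
proof (induction K arbitrary: L g rule: finite_induct)
  case empty
  then show ?case by (intro exI[of _ "\<lambda>_. 1"]) (auto simp: card_gt_0_iff)
next
  case (insert k K)
  show ?case
  proof (cases "\<forall>l\<in>L. g k l = 0")
    case True
    have "card K < card L" using insert by simp
    from insert.IH[OF insert.prems(1) this, of g] True show ?thesis by auto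
  next
    case False
    then obtain l0 where l0: "l0 \<in> L" "g k l0 \<noteq> 0" by auto
    define L' where "L' = L - {l0}"
    define g' where "g' k' l = g k' l - g k' l0 / g k l0 * g k l" for k' l
    have L': "finite L'" "card K < card L'"
      using insert l0 by (auto simp: L'_def)
    obtain d where d: "\<exists>l\<in>L'. d l \<noteq> 0" "\<forall>k'\<in>K. (\<Sum>l\<in>L'. d l * g' k' l) = 0"
      using insert.IH[OF L', of g'] by auto
    define d' where "d' = d(l0 := - (\<Sum>l\<in>L'. d l * g k l) / g k l0)"
    have d'_sum: "(\<Sum>l\<in>L. d' l * h l) = - (\<Sum>l\<in>L'. d l * g k l) / g k l0 * h l0 + (\<Sum>l\<in>L'. d l * h l)"
      for h
      unfolding L'_def d'_def using insert.prems l0 by (subst sum.remove[of _ l0]) auto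
    have "(\<Sum>l\<in>L. d' l * g k' l) = 0" if "k' \<in> insert k K" for k'
    proof (cases "k' = k")
      case True
      then show ?thesis using l0 by (simp add: d'_sum)
    next
      case False
      then have "(\<Sum>l\<in>L'. d l * g k' l) - g k' l0 / g k l0 * (\<Sum>l\<in>L'. d l * g k l) = 0"
        using d(2) that by (simp add: g'_def right_diff_distrib sum_subtractf sum_distrib_left mult.left_commute)
      then show ?thesis by (simp add: d'_sum)
    qed
    moreover have "\<exists>l\<in>L. d' l \<noteq> 0"
      using d(1) by (auto simp: L'_def d'_def)
    ultimately show ?thesis by blast
  qed
qed

text \<open>A basic solution of the linear program that maximizes \<open>f\<close> under the equality constraints
  \<open>K\<close>; one inequality is thereby kept at no cost in the number of labels.\<close>

lemma caratheodory_lp: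
  fixes K :: "('l \<Rightarrow> real) set" and f :: "'l \<Rightarrow> real"
  assumes "finite L" "finite K" "\<And>l. l \<in> L \<Longrightarrow> 0 \<le> c l"
    and "\<And>l. l \<in> L \<Longrightarrow> \<exists>k\<in>K. 0 < k l \<and> (\<forall>l'\<in>L. 0 \<le> k l')"
  shows "\<exists>L' w. L' \<subseteq> L \<and> card L' \<le> card K \<and> (\<forall>l\<in>L'. 0 \<le> w l) \<and>
    (\<forall>k\<in>K. (\<Sum>l\<in>L'. w l * k l) = (\<Sum>l\<in>L. c l * k l)) \<and>
    (\<Sum>l\<in>L. c l * f l) \<le> (\<Sum>l\<in>L'. w l * f l)"
  using assms
proof (induction "card L" arbitrary: L c rule: less_induct)
  case less
  show ?case
  proof (cases "card L \<le> card K")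
    case True
    then show ?thesis using less.prems by (intro exI[of _ L] exI[of _ c]) auto
  next
    case False
    then obtain d0 where d0: "\<exists>l\<in>L. d0 l \<noteq> 0" "\<forall>k\<in>K. (\<Sum>l\<in>L. d0 l * k l) = 0"
      using homogeneous_system_nontrivial[of K L "\<lambda>k. k"] less.prems by auto
    \<comment> \<open>A direction along which all constraints stay constant, with the sign chosen so
      that the objective does not decrease.\<close>
    define d where "d = (if 0 \<le> (\<Sum>l\<in>L. d0 l * f l) then d0 else (\<lambda>l. - d0 l))"
    have d: "\<exists>l\<in>L. d l \<noteq> 0" "\<forall>k\<in>K. (\<Sum>l\<in>L. d l * k l) = 0" "0 \<le> (\<Sum>l\<in>L. d l * f l)"
      using d0 by (auto simp: d_def sum_negf)
    \<comment> \<open>A nonzero direction without negative entries is positive at some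
      \<open>l\<close>, and the constraint that is nonnegative on \<open>L\<close> and positive at
      \<open>l\<close> would then not vanish on it.\<close>
    have "\<exists>l\<in>L. d l < 0"
    proof (rule ccontr)
      assume "\<not> ?thesis"
      then have nn: "\<forall>l\<in>L. 0 \<le> d l" by auto
      then obtain l where l: "l \<in> L" "0 < d l" using d(1) by force
      obtain k where k: "k \<in> K" "0 < k l" "\<forall>l'\<in>L. 0 \<le> k l'" using less.prems(4)[OF l(1)] by blast
      have "0 < (\<Sum>l\<in>L. d l * k l)"
        using less.prems(1) l k nn by (intro sum_pos2[where i = l]) auto
      then show False using d(2) k(1) by auto
    qed
    then have ne: "{l \<in> L. d l < 0} \<noteq> {}" by auto
    have fin: "finite {l \<in> L. d l < 0}" using less.prems by simp
    obtain m where m: "m \<in> L" "d m < 0" "\<And>l. l \<in> L \<Longrightarrow> d l < 0 \<Longrightarrow> c m / - d m \<le> c l / - d l"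
      using ex_min_if_finite[OF finite_imageI[OF fin] , of "\<lambda>l. c l / - d l"] ne
      by (force simp: not_less)
    define t where "t = c m / - d m"
    have t: "0 \<le> t" unfolding t_def using m less.prems(3)[of m] by (intro divide_nonneg_pos) auto
    define c' where "c' l = c l + t * d l" for l
    have c'0: "0 \<le> c' l" if l: "l \<in> L" for l
    proof (cases "d l < 0")
      case True
      then have "t \<le> c l / - d l" using m(3)[OF l] by (simp add: t_def)
      then have "t * - d l \<le> c l" using True pos_le_divide_eq[of "- d l" t "c l"] by linarith
      then show ?thesis by (simp add: c'_def)
    next
      case False
      then show ?thesis using t less.prems(3)[OF l] by (simp add: c'_def)
    qed
    have c'm: "c' m = 0" using m by (simp add: c'_def t_def)
    define L2 where "L2 = L - {m}"
    have L2_sum: "(\<Sum>l\<in>L2. c' l * h l) = (\<Sum>l\<in>L. c l * h l) + t * (\<Sum>l\<in>L. d l * h l)" for h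
    proof -
      have "(\<Sum>l\<in>L2. c' l * h l) = (\<Sum>l\<in>L. c' l * h l)"
        unfolding L2_def using less.prems(1) m(1) c'm by (subst (2) sum.remove[of _ m]) auto
      then show ?thesis by (simp add: c'_def algebra_simps sum.distrib sum_distrib_left)
    qed
    have "\<exists>L' w. L' \<subseteq> L2 \<and> card L' \<le> card K \<and> (\<forall>l\<in>L'. 0 \<le> w l) \<and>
        (\<forall>k\<in>K. (\<Sum>l\<in>L'. w l * k l) = (\<Sum>l\<in>L2. c' l * k l)) \<and>
        (\<Sum>l\<in>L2. c' l * f l) \<le> (\<Sum>l\<in>L'. w l * f l)"
    proof (rule less.hyps)
      show "card L2 < card L" unfolding L2_def using less.prems(1) m(1) by (rule card_Diff1_less)
      fix l assume "l \<in> L2"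
      then have "l \<in> L" by (simp add: L2_def)
      then obtain k where "k \<in> K" "0 < k l" "\<forall>l'\<in>L. 0 \<le> k l'" using less.prems(4) by blast
      then show "\<exists>k\<in>K. 0 < k l \<and> (\<forall>l'\<in>L2. 0 \<le> k l')" by (auto simp: L2_def)
    qed (use less.prems c'0 in \<open>auto simp: L2_def\<close>)
    then obtain L' w where w: "L' \<subseteq> L2" "card L' \<le> card K" "\<forall>l\<in>L'. 0 \<le> w l"
      "\<forall>k\<in>K. (\<Sum>l\<in>L'. w l * k l) = (\<Sum>l\<in>L2. c' l * k l)"
      "(\<Sum>l\<in>L2. c' l * f l) \<le> (\<Sum>l\<in>L'. w l * f l)" by blast
    have "(\<Sum>l\<in>L. c l * f l) \<le> (\<Sum>l\<in>L'. w l * f l)"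
      using w(5) d(3) t L2_sum[of f] mult_nonneg_nonneg[OF t d(3)] by linarith
    moreover have "\<forall>k\<in>K. (\<Sum>l\<in>L'. w l * k l) = (\<Sum>l\<in>L. c l * k l)"
      using w(4) d(2) L2_sum by simp
    moreover have "L' \<subseteq> L" using w(1) by (auto simp: L2_def)
    ultimately show ?thesis using w by blast
  qed
qed

section \<open>Compactness\<close>

text \<open>From \<open>ln x \<le> x - 1\<close> at \<open>x = 1 / sqrt y\<close>. The majorant is
  continuous and vanishes at 0, which is what the next limit needs.\<close>

lemma entropy_term_bound:
  fixes y :: real
  assumes y: "0 \<le> y" "y \<le> 1"
  shows "\<bar>y * - log 2 y\<bar> \<le> 2 / ln 2 * sqrt y"
proof (cases "y = 0")
  case False
  then have y0: "0 < y" using y by simp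
  have "- ln y = 2 * ln (1 / sqrt y)"
    using y0 by (simp add: ln_div ln_sqrt)
  also have "\<dots> \<le> 2 * (1 / sqrt y)"
    using ln_le_minus_one[of "1 / sqrt y"] y0 by simp
  finally have "y * - ln y \<le> y * (2 * (1 / sqrt y))"
    by (rule mult_left_mono) fact
  also have "y * (2 * (1 / sqrt y)) = 2 * (y / sqrt y)"
    by (rule mult.left_commute[THEN trans]) simp
  also have "\<dots> = 2 * sqrt y"
    using real_div_sqrt[OF y(1)] by (rule arg_cong)
  finally have "y * - ln y / ln 2 \<le> 2 * sqrt y / ln 2"
    by (rule divide_right_mono) simp
  moreover have "y * - log 2 y = y * - ln y / ln 2"
    by (simp add: log_def)
  moreover have "log 2 y \<le> 0" using y0 y(2) by simp
  then have "0 \<le> y * - log 2 y" using y(1) mult_nonneg_nonneg[of y "- log 2 y"] by linarith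
  ultimately show ?thesis by (simp only: abs_of_nonneg times_divide_eq_left)
qed simp

text \<open>Away from 0 the logarithm is continuous; at \<open>l = 0\<close> the terms are squeezed
  by a multiple of \<open>sqrt (x m)\<close>.\<close>

lemma tendsto_entropy_term:
  fixes x :: "nat \<Rightarrow> real"
  assumes x: "x \<longlonglongrightarrow> l" and nonneg: "\<And>m. 0 \<le> x m"
  shows "(\<lambda>m. x m * - log 2 (x m)) \<longlonglongrightarrow> l * - log 2 l"
proof (cases "l = 0")
  case False
  moreover have "0 \<le> l" by (rule LIMSEQ_le_const[OF x]) (use nonneg in blast)
  ultimately have "0 < l" by simp
  then show ?thesis
    by (intro tendsto_mult tendsto_minus x tendsto_log tendsto_const) auto
next
  case True
  have "(\<lambda>m. 2 / ln 2 * sqrt (x m)) \<longlonglongrightarrow> 2 / ln 2 * sqrt l"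
    by (intro tendsto_mult tendsto_const tendsto_real_sqrt x)
  moreover have "\<forall>\<^sub>F m in sequentially. x m < 1"
    by (rule order_tendstoD(2)[OF x]) (simp add: True)
  then have "\<forall>\<^sub>F m in sequentially. norm (x m * - log 2 (x m)) \<le> 2 / ln 2 * sqrt (x m)"
    unfolding real_norm_def by (rule eventually_mono) (rule entropy_term_bound[OF nonneg], simp)
  ultimately have "(\<lambda>m. x m * - log 2 (x m)) \<longlonglongrightarrow> 0"
    unfolding True real_sqrt_zero mult_zero_right by (rule Lim_null_comparison[rotated])
  then show ?thesis by (simp only: True mult_zero_left)
qed

text \<open>Bolzano-Weierstrass one coordinate at a time; passing to a further subsequence keeps the
  limits already obtained.\<close>

lemma bounded_family_convergent_subseq:
  fixes f :: "nat \<Rightarrow> 'd \<Rightarrow> real"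
  assumes "finite D" "\<And>m d. d \<in> D \<Longrightarrow> \<bar>f m d\<bar> \<le> C"
  shows "\<exists>r. strict_mono (r :: nat \<Rightarrow> nat) \<and> (\<forall>d\<in>D. convergent (\<lambda>m. f (r m) d))"
  using assms
proof (induction D rule: finite_induct)
  case empty
  show ?case by (intro exI[of _ id]) (auto simp: strict_mono_id)
next
  case (insert d D)
  then obtain r where r: "strict_mono r" "\<forall>d\<in>D. convergent (\<lambda>m. f (r m) d)" by auto
  have "bounded (range (\<lambda>m. f (r m) d))"
    using insert.prems[of d] by (auto simp: bounded_iff)
  then obtain l s where s: "strict_mono s" "((\<lambda>m. f (r m) d) \<circ> s) \<longlonglongrightarrow> l"
    using bounded_imp_convergent_subsequence by blast
  have "convergent (\<lambda>m. f ((r \<circ> s) m) d')" if "d' \<in> insert d D" for d'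
  proof (cases "d' = d")
    case True
    then show ?thesis using s(2) by (auto simp: convergent_def o_def)
  next
    case False
    then show ?thesis using r(2) that convergent_subseq_convergent[OF _ s(1), of "\<lambda>m. f (r m) d'"]
      by (auto simp: o_def)
  qed
  then show ?case using strict_mono_o[OF r(1) s(1)] by blast
qed

section \<open>Random variables on a finite probability space\<close>

lemma pmf_with_finite_support:
  fixes f :: "'a \<Rightarrow> real"
  assumes "finite D" "\<And>x. 0 \<le> f x" "\<And>x. x \<notin> D \<Longrightarrow> f x = 0" "sum f D = 1"
  shows "\<exists>J. \<forall>x. pmf J x = f x"
proof -
  have "(\<integral>\<^sup>+x. ennreal (f x) \<partial>count_space UNIV) = (\<integral>\<^sup>+x. ennreal (f x) \<partial>count_space D)"
    using assms(3) by (intro nn_integral_count_space_eq) auto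
  also have "\<dots> = 1"
    using assms by (simp add: nn_integral_count_space_finite sum_ennreal)
  finally show ?thesis
    using assms(2) by (intro exI[of _ "embed_pmf f"]) (simp add: pmf_embed_pmf)
qed

lemma marg_pmf:
  assumes "finite D" "set_pmf J \<subseteq> D"
  shows "pmf (map_pmf X J) v = marg D (pmf J) X v"
proof -
  have "pmf (map_pmf X J) v = measure_pmf.prob J (X -` {v})"
    by (rule pmf_map)
  also have "\<dots> = measure_pmf.prob J {s \<in> D. X s = v}"
    using assms by (intro measure_pmf.finite_measure_eq_AE) (auto simp: AE_measure_pmf_iff)
  also have "\<dots> = marg D (pmf J) X v"
    unfolding marg_def using assms by (intro measure_measure_pmf_finite) auto
  finally show ?thesis .
qed

lemma distributed_pmf:
  "distributed (measure_pmf J) (count_space UNIV) X (\<lambda>v. ennreal (pmf (map_pmf X J) v))"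
  unfolding distributed_def
  by (auto simp: map_pmf_rep_eq[symmetric] measure_pmf_eq_density[symmetric])

text \<open>The bridge from the measure-theoretic information, an integral over a product of
  counting measures. Countability makes this product a counting measure again, and the integrand
  vanishes off the finite image of \<open>D\<close>.\<close>

lemma MI_eq:
  fixes X :: "'w \<Rightarrow> 'a::countable" and Y :: "'w \<Rightarrow> 'b::countable"
  assumes D: "finite D" "set_pmf J \<subseteq> D"
  shows "MI J X Y = Ent D (pmf J) X + Ent D (pmf J) Y - Ent D (pmf J) (\<lambda>s. (X s, Y s))"
proof -
  interpret information_space "measure_pmf J" 2
    by unfold_locales simp
  interpret W: weighted_set D "pmf J"
    using D by unfold_locales auto
  have sf: "sigma_finite_measure (count_space (UNIV :: 'a set))" "sigma_finite_measure (count_space (UNIV :: 'b set))"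
    by (auto intro!: sigma_finite_measure_count_space_countable)
  have pair: "count_space (UNIV :: 'a set) \<Otimes>\<^sub>M count_space (UNIV :: 'b set) = count_space UNIV"
    by (simp add: pair_measure_countable)
  let ?x = "marg D (pmf J) X" and ?y = "marg D (pmf J) Y" and ?xy = "marg D (pmf J) (\<lambda>s. (X s, Y s))"
  let ?f = "\<lambda>v. ?xy v * log 2 (?xy v / (?x (fst v) * ?y (snd v)))"
  have "MI J X Y = (\<integral>v. ?f v \<partial>(count_space UNIV \<Otimes>\<^sub>M count_space UNIV))"
    using distributed_pmf[of J X] distributed_pmf[of J Y] distributed_pmf[of J "\<lambda>s. (X s, Y s)"]
    unfolding marg_pmf[OF D]
    by (intro mutual_information_distr[OF sf]) (auto simp: pair marg_nonneg)
  also have "\<dots> = (\<Sum>v | v \<in> UNIV \<and> ?f v \<noteq> 0. ?f v)"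
  proof -
    have "?xy v = 0" if "v \<notin> (\<lambda>s. (X s, Y s)) ` D" for v
      unfolding marg_def using that by (intro sum.neutral) auto
    then have "{v \<in> UNIV. ?f v \<noteq> 0} \<subseteq> (\<lambda>s. (X s, Y s)) ` D" by auto
    then show ?thesis
      unfolding pair using D(1) by (intro lebesgue_integral_count_space_finite_support) (auto intro: finite_subset)
  qed
  also have "\<dots> = (\<Sum>v\<in>(\<lambda>s. (X s, Y s)) ` D. ?f v)"
  proof (rule sum.mono_neutral_left)
    have "?xy v = 0" if "v \<notin> (\<lambda>s. (X s, Y s)) ` D" for v
      unfolding marg_def using that by (intro sum.neutral) auto
    then show "{v \<in> UNIV. ?f v \<noteq> 0} \<subseteq> (\<lambda>s. (X s, Y s)) ` D" by auto
  qed (use D in auto)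
  also have "\<dots> = (\<Sum>s\<in>D. pmf J s * log 2 (?xy (X s, Y s) / (?x (X s) * ?y (Y s))))"
    using sum_marg[of D "(\<lambda>s. (X s, Y s)) ` D" "\<lambda>s. (X s, Y s)" "pmf J"
        "\<lambda>v. log 2 (?xy v / (?x (fst v) * ?y (snd v)))"] D by simp
  also have "\<dots> = (\<Sum>s\<in>D. pmf J s * - log 2 (?x (X s)) + pmf J s * - log 2 (?y (Y s))
      - pmf J s * - log 2 (?xy (X s, Y s)))"
  proof (rule sum.cong)
    fix s assume s: "s \<in> D"
    show "pmf J s * log 2 (?xy (X s, Y s) / (?x (X s) * ?y (Y s))) =
      pmf J s * - log 2 (?x (X s)) + pmf J s * - log 2 (?y (Y s)) - pmf J s * - log 2 (?xy (X s, Y s))"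
    proof (cases "pmf J s = 0")
      case False
      then have "0 < pmf J s" by (simp add: less_le)
      then show ?thesis
        using W.marg_pos[OF s, of X] W.marg_pos[OF s, of Y] W.marg_pos[OF s, of "\<lambda>s. (X s, Y s)"]
        by (simp add: log_divide log_mult algebra_simps)
    qed simp
  qed simp
  finally show ?thesis
    unfolding Ent_def by (simp only: sum.distrib sum_subtractf)
qed

lemma MI_eq_cmi:
  fixes X :: "'w \<Rightarrow> 'a::countable" and Y :: "'w \<Rightarrow> 'b::countable"
  assumes D: "finite D" "set_pmf J \<subseteq> D"
  shows "MI J X Y = cmi D (pmf J) X Y (\<lambda>_. ())"
proof -
  have "Ent D (pmf J) (\<lambda>s. (Y s, X s, ())) = Ent D (pmf J) (\<lambda>s. (X s, Y s))"
    "Ent D (pmf J) (\<lambda>s. (Y s, ())) = Ent D (pmf J) Y" "Ent D (pmf J) (\<lambda>s. (X s, ())) = Ent D (pmf J) X"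
    by (intro Ent_fun_cong; force)+
  then show ?thesis
    unfolding MI_eq[OF D] cmi_def cond_Ent_def using sum_pmf_eq_1[OF D] by (simp add: Ent_const)
qed

text \<open>The measure-theoretic notion is the information of \<open>X\<close> with
  \<open>(Y, Z)\<close> minus that with \<open>Z\<close>; the entropy of \<open>X\<close> cancels in
  this difference.\<close>

lemma CMI_eq_cmi:
  fixes X :: "'w \<Rightarrow> 'a::countable" and Y :: "'w \<Rightarrow> 'b::countable" and Z :: "'w \<Rightarrow> 'c::countable"
  assumes D: "finite D" "set_pmf J \<subseteq> D"
  shows "CMI J X Y Z = cmi D (pmf J) X Y Z"
proof -
  have pair: "count_space (UNIV :: 'b set) \<Otimes>\<^sub>M count_space (UNIV :: 'c set) = count_space UNIV"
    by (simp add: pair_measure_countable)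
  have "Ent D (pmf J) (\<lambda>s. (X s, Y s, Z s)) = Ent D (pmf J) (\<lambda>s. (Y s, X s, Z s))"
    by (rule Ent_fun_cong) auto
  then show ?thesis
    unfolding prob_space.conditional_mutual_information_def[OF measure_pmf.prob_space_axioms] pair MI_eq[OF D] cmi_def cond_Ent_def
    by simp
qed

section \<open>The outer bound\<close>

lemma functionals_zero:
  "rate P c (\<lambda>x. 0) = 0" "info1 P (\<lambda>x. 0) = 0" "info2 P (\<lambda>x. 0) = 0" "balance P (\<lambda>x. 0) = 0"
  using functionals_scale[of 0 "\<lambda>_. 0" P] by simp_all

lemma outer_bounds_few_labels:
  fixes P :: "('x1::finite, 'x2::finite, 'y1::finite, 'y2::finite, 'f1::finite, 'f2::finite) icgf"
    and b :: "'l \<Rightarrow> 'x1 \<times> 'x2 \<Rightarrow> real"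
  assumes ob: "outer_bounds P L b r1 r2 r12"
  shows "\<exists>b' :: nat \<Rightarrow> 'x1 \<times> 'x2 \<Rightarrow> real. outer_bounds P {..<CARD('x1) * CARD('x2) + 3} b' r1 r2 r12"
proof -
  let ?N = "CARD('x1) * CARD('x2) + 3"
  have L: "finite L" and b0: "\<And>l x. 0 \<le> b l x" and b1: "(\<Sum>l\<in>L. \<Sum>x\<in>UNIV. b l x) = 1"
    using ob by (auto simp: outer_bounds_def)
  \<comment> \<open>The quantities held fixed: three functionals and the coordinates of the marginal
    input law, hence the \<open>+ 3\<close>. The total mass is the sum of the coordinates and is
    preserved with them; \<open>info1\<close> is the objective.\<close>
  define K where "K = insert (\<lambda>l. info2 P (b l)) (insert (\<lambda>l. rate P (\<lambda>u. u) (b l))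
    (insert (\<lambda>l. balance P (b l)) (range (\<lambda>x l. b l x))))"
  have cardK: "card K \<le> ?N"
  proof -
    have "card (range (\<lambda>x l. b l x)) \<le> CARD('x1) * CARD('x2)"
      using card_image_le[of "UNIV :: ('x1 \<times> 'x2) set" "\<lambda>x l. b l x"] by simp
    moreover have "card K \<le> Suc (Suc (Suc (card (range (\<lambda>x l. b l x)))))"
      unfolding K_def by (intro order.trans[OF card_insert_le_m1] order.refl) (auto intro!: card_insert_le_m1 simp: card_insert_if)
    ultimately show ?thesis by linarith
  qed
  \<comment> \<open>Without zero slices every label has a positive coordinate, the kind of
    constraint that \<open>caratheodory_lp\<close> asks for.\<close>
  define L0 where "L0 = {l \<in> L. \<exists>x. b l x \<noteq> 0}"
  have L0: "(\<Sum>l\<in>L0. 1 * \<phi> (b l)) = (\<Sum>l\<in>L. \<phi> (b l))" if "\<phi> (\<lambda>x. 0) = 0" for \<phi> :: "('x1 \<times> 'x2 \<Rightarrow> real) \<Rightarrow> real"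
  proof -
    have "\<phi> (b l) = 0" if "l \<in> L - L0" for l
    proof -
      have "b l = (\<lambda>x. 0)" using that by (auto simp: L0_def)
      then show ?thesis using \<open>\<phi> (\<lambda>x. 0) = 0\<close> by simp
    qed
    then show ?thesis
      unfolding mult_1 using L by (intro sum.mono_neutral_left) (auto simp: L0_def)
  qed
  \<comment> \<open>The initial weights are 1, because the slices already carry the probabilities of
    the labels.\<close>
  have "\<exists>L' w. L' \<subseteq> L0 \<and> card L' \<le> card K \<and> (\<forall>l\<in>L'. 0 \<le> w l) \<and>
    (\<forall>k\<in>K. (\<Sum>l\<in>L'. w l * k l) = (\<Sum>l\<in>L0. 1 * k l)) \<and>
    (\<Sum>l\<in>L0. 1 * info1 P (b l)) \<le> (\<Sum>l\<in>L'. w l * info1 P (b l))"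
  proof (rule caratheodory_lp)
    fix l assume "l \<in> L0"
    then obtain x where "0 < b l x" using b0[of l] by (auto simp: L0_def less_le)
    then show "\<exists>k\<in>K. 0 < k l \<and> (\<forall>l'\<in>L0. 0 \<le> k l')"
      by (intro bexI[of _ "\<lambda>l. b l x"]) (auto simp: K_def b0)
  qed (use L in \<open>auto simp: L0_def K_def\<close>)
  then obtain L' w where L': "L' \<subseteq> L0" "card L' \<le> card K" "\<And>l. l \<in> L' \<Longrightarrow> 0 \<le> w l"
    and K: "\<And>k. k \<in> K \<Longrightarrow> (\<Sum>l\<in>L'. w l * k l) = (\<Sum>l\<in>L0. 1 * k l)"
    and i1: "(\<Sum>l\<in>L0. 1 * info1 P (b l)) \<le> (\<Sum>l\<in>L'. w l * info1 P (b l))" by blast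
  have finL': "finite L'" using L' L by (auto simp: L0_def intro: finite_subset)
  obtain e where e: "inj_on e L'" "e ` L' \<subseteq> {..<?N}"
    using inj_on_iff_card_le[of L' "{..<?N}"] finL' L'(2) cardK by auto
  \<comment> \<open>The surviving labels are renamed by numbers; a number left over gets the zero
    slice, on which all functionals vanish.\<close>
  define b' where "b' j = (if j \<in> e ` L' then (\<lambda>x. w (inv_into L' e j) * b (inv_into L' e j) x) else (\<lambda>x. 0))" for j
  have b': "(\<Sum>j<?N. \<phi> (b' j)) = (\<Sum>l\<in>L'. \<phi> (\<lambda>x. w l * b l x))" if "\<phi> (\<lambda>x. 0) = 0" for \<phi> :: "('x1 \<times> 'x2 \<Rightarrow> real) \<Rightarrow> real"
  proof -
    have "(\<Sum>j<?N. \<phi> (b' j)) = (\<Sum>j\<in>e ` L'. \<phi> (b' j))"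
      using e(2) that by (intro sum.mono_neutral_right) (auto simp: b'_def)
    also have "\<dots> = (\<Sum>l\<in>L'. \<phi> (b' (e l)))"
      by (simp add: sum.reindex[OF e(1)])
    also have "\<dots> = (\<Sum>l\<in>L'. \<phi> (\<lambda>x. w l * b l x))"
      using e(1) by (intro sum.cong) (auto simp: b'_def)
    finally show ?thesis .
  qed
  have coord: "(\<Sum>j<?N. b' j x) = (\<Sum>l\<in>L. b l x)" for x
    using b'[of "\<lambda>b. b x"] K[of "\<lambda>l. b l x"] L0[of "\<lambda>b. b x"] by (simp add: K_def)
  have kept: "(\<Sum>j<?N. \<phi> (b' j)) = (\<Sum>l\<in>L. \<phi> (b l))"
    if "(\<lambda>l. \<phi> (b l)) \<in> K" "\<phi> (\<lambda>x. 0) = 0" "\<And>l. l \<in> L' \<Longrightarrow> \<phi> (\<lambda>x. w l * b l x) = w l * \<phi> (b l)" for \<phi>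
    using b'[of \<phi>] K[OF that(1)] L0[of \<phi>] that by simp
  note scale = functionals_scale[OF L'(3) b0]
  have info1: "(\<Sum>l\<in>L. info1 P (b l)) \<le> (\<Sum>j<?N. info1 P (b' j))"
    using b'[of "info1 P"] i1 L0[of "info1 P"] by (simp add: functionals_zero scale)
  have info2: "(\<Sum>j<?N. info2 P (b' j)) = (\<Sum>l\<in>L. info2 P (b l))"
    by (rule kept) (auto simp: K_def functionals_zero intro: scale)
  have rate: "(\<Sum>j<?N. rate P (\<lambda>u. u) (b' j)) = (\<Sum>l\<in>L. rate P (\<lambda>u. u) (b l))"
    by (rule kept) (auto simp: K_def functionals_zero intro: scale)
  have balance: "(\<Sum>j<?N. balance P (b' j)) = (\<Sum>l\<in>L. balance P (b l))"
    by (rule kept) (auto simp: K_def functionals_zero intro: scale)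
  have nonneg: "0 \<le> b' j x" for j x
    using L'(3) b0 by (auto simp: b'_def inv_into_into)
  have "(\<Sum>j<?N. \<Sum>x\<in>UNIV. b' j x) = 1"
    using b1 by (subst sum.swap) (simp add: coord sum.swap[of _ UNIV L])
  then have "outer_bounds P {..<?N} b' r1 r2 r12"
    using ob info1 nonneg unfolding outer_bounds_def coord info2 rate balance by (simp add: order.trans)
  then show ?thesis by (intro exI)
qed

text \<open>Written over the fixed finite set of values (\<open>Ent_eq_sum\<close>), an entropy is a
  finite sum of terms \<open>y * - log 2 y\<close> in the marginals, continuous also where a
  marginal tends to 0.\<close>

lemma cmi_tendsto:
  assumes "finite S" "\<And>m s. s \<in> S \<Longrightarrow> 0 \<le> a m s" "\<And>s. s \<in> S \<Longrightarrow> (\<lambda>m. a m s) \<longlonglongrightarrow> a' s"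
  shows "(\<lambda>m. cmi S (a m) X Y Z) \<longlonglongrightarrow> cmi S a' X Y Z"
proof -
  have Ent: "(\<lambda>m. Ent S (a m) f) \<longlonglongrightarrow> Ent S a' f" for f :: "'a \<Rightarrow> 'v"
  proof -
    have "(\<lambda>m. marg S (a m) f v) \<longlonglongrightarrow> marg S a' f v" for v
      unfolding marg_def using assms by (intro tendsto_sum) auto
    moreover have "0 \<le> marg S (a m) f v" for m v
      using assms by (intro marg_nonneg) auto
    ultimately show ?thesis
      unfolding Ent_eq_sum[OF assms(1) finite_imageI[OF assms(1)] order.refl]
      by (intro tendsto_sum tendsto_entropy_term)
  qed
  show ?thesis
    unfolding cmi_def cond_Ent_def
    by (intro tendsto_diff Ent)
qed

lemma functionals_tendsto:
  assumes "\<And>m x. 0 \<le> b m x" "\<And>x. (\<lambda>m. b m x) \<longlonglongrightarrow> b' x"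
  shows "(\<lambda>m. rate P c (b m)) \<longlonglongrightarrow> rate P c b'" "(\<lambda>m. info1 P (b m)) \<longlonglongrightarrow> info1 P b'"
    "(\<lambda>m. info2 P (b m)) \<longlonglongrightarrow> info2 P b'" "(\<lambda>m. balance P (b m)) \<longlonglongrightarrow> balance P b'"
proof -
  have "(\<lambda>m. joint_weight P (b m) r) \<longlonglongrightarrow> joint_weight P b' r" for r
    unfolding joint_weight_def using assms(2) by (cases r) (auto intro!: tendsto_intros)
  then have lim: "(\<lambda>m. cmi UNIV (joint_weight P (b m)) X Y Z) \<longlonglongrightarrow> cmi UNIV (joint_weight P b') X Y Z"
    for X :: "_ \<Rightarrow> 'u" and Y :: "_ \<Rightarrow> 'v" and Z :: "_ \<Rightarrow> 'w"
    by (intro cmi_tendsto joint_weight_nonneg assms) auto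
  show "(\<lambda>m. rate P c (b m)) \<longlonglongrightarrow> rate P c b'" "(\<lambda>m. info1 P (b m)) \<longlonglongrightarrow> info1 P b'"
    "(\<lambda>m. info2 P (b m)) \<longlonglongrightarrow> info2 P b'" "(\<lambda>m. balance P (b m)) \<longlonglongrightarrow> balance P b'"
    unfolding functional_defs by (intro lim tendsto_diff)+
qed

text \<open>For a fixed finite \<open>L\<close> the slices have finitely many coordinates in
  \<open>[0, 1]\<close>, and weak inequalities between continuous functionals survive along a
  convergent subsequence.\<close>

lemma outer_bounds_limit:
  fixes b :: "nat \<Rightarrow> 'l \<Rightarrow> 'x1::finite \<times> 'x2::finite \<Rightarrow> real"
    and P :: "('x1, 'x2, 'y1::finite, 'y2::finite, 'f1::finite, 'f2::finite) icgf"
  assumes ob: "\<And>m. outer_bounds P L (b m) (r1 m) (r2 m) (r12 m)"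
    and r: "r1 \<longlonglongrightarrow> R1" "r2 \<longlonglongrightarrow> R2" "r12 \<longlonglongrightarrow> R12"
  shows "\<exists>b'. outer_bounds P L b' R1 R2 R12"
proof -
  have L: "finite L" and b0: "\<And>m l x. 0 \<le> b m l x" and b1: "\<And>m. (\<Sum>l\<in>L. \<Sum>x\<in>UNIV. b m l x) = 1"
    using ob by (auto simp: outer_bounds_def)
  have "\<bar>(\<lambda>(l, x). b m l x) d\<bar> \<le> 1" if L_x: "d \<in> L \<times> UNIV" for m d
  proof -
    obtain l x where d: "d = (l, x)" "l \<in> L" using L_x by (rule SigmaE)
    have "b m l x \<le> (\<Sum>x\<in>UNIV. b m l x)"
      using b0 by (intro member_le_sum) auto
    also have "\<dots> \<le> (\<Sum>l\<in>L. \<Sum>x\<in>UNIV. b m l x)"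
      using b0 L d by (intro member_le_sum) (auto intro!: sum_nonneg)
    finally show ?thesis using b1[of m] b0[of m l x] d by simp
  qed
  then obtain s where s: "strict_mono (s :: nat \<Rightarrow> nat)" "\<And>l x. l \<in> L \<Longrightarrow> convergent (\<lambda>m. b (s m) l x)"
    using bounded_family_convergent_subseq[of "L \<times> UNIV" "\<lambda>m (l, x). b m l x" 1] L by auto
  \<comment> \<open>No limit is known off \<open>L\<close>; the value 0 there meets the
    nonnegativity that \<open>outer_bounds\<close> demands at every label.\<close>
  define b' where "b' l x = (if l \<in> L then lim (\<lambda>m. b (s m) l x) else 0)" for l x
  have lim: "(\<lambda>m. b (s m) l x) \<longlonglongrightarrow> b' l x" if "l \<in> L" for l x
    using s(2)[OF that, of x] that by (simp add: b'_def convergent_LIMSEQ_iff)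
  have b'0: "0 \<le> b' l x" for l x
    using LIMSEQ_le_const[OF lim[of l x], of 0] b0 by (cases "l \<in> L") (auto simp: b'_def)
  have lim_sum: "(\<lambda>m. \<Sum>l\<in>L. b (s m) l x) \<longlonglongrightarrow> (\<Sum>l\<in>L. b' l x)" for x
    by (intro tendsto_sum lim)
  have sum0: "0 \<le> (\<Sum>l\<in>L. b (s m) l x)" for m x by (intro sum_nonneg b0)
  have rs: "(\<lambda>m. r1 (s m)) \<longlonglongrightarrow> R1" "(\<lambda>m. r2 (s m)) \<longlonglongrightarrow> R2" "(\<lambda>m. r12 (s m)) \<longlonglongrightarrow> R12"
    using r[THEN LIMSEQ_subseq_LIMSEQ, OF s(1)] by (auto simp: o_def)
  note total = functionals_tendsto[where b = "\<lambda>m x. \<Sum>l\<in>L. b (s m) l x", OF sum0 lim_sum]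
  have label: "(\<lambda>m. rate P (\<lambda>u. u) (b (s m) l)) \<longlonglongrightarrow> rate P (\<lambda>u. u) (b' l)"
    "(\<lambda>m. info1 P (b (s m) l)) \<longlonglongrightarrow> info1 P (b' l)"
    "(\<lambda>m. info2 P (b (s m) l)) \<longlonglongrightarrow> info2 P (b' l)"
    "(\<lambda>m. balance P (b (s m) l)) \<longlonglongrightarrow> balance P (b' l)" if "l \<in> L" for l
    using functionals_tendsto[where b = "\<lambda>m. b (s m) l", OF b0 lim[OF that]] by auto
  have "(\<lambda>m. \<Sum>l\<in>L. \<Sum>x\<in>UNIV. b (s m) l x) \<longlonglongrightarrow> (\<Sum>l\<in>L. \<Sum>x\<in>UNIV. b' l x)"
    by (intro tendsto_sum lim)
  then have b'1: "(\<Sum>l\<in>L. \<Sum>x\<in>UNIV. b' l x) = 1"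
    unfolding b1 using LIMSEQ_unique tendsto_const by blast
  have bounds: "r1 m \<le> rate P (\<lambda>(y1, y2, z1, z2). y1) (\<lambda>x. \<Sum>l\<in>L. b m l x)"
    "r2 m \<le> rate P (\<lambda>(y1, y2, z1, z2). y2) (\<lambda>x. \<Sum>l\<in>L. b m l x)"
    "r12 m \<le> rate P (\<lambda>(y1, y2, z1, z2). (y1, y2)) (\<lambda>x. \<Sum>l\<in>L. b m l x)"
    "r1 m \<le> (\<Sum>l\<in>L. info1 P (b m l))" "r2 m \<le> (\<Sum>l\<in>L. info2 P (b m l))"
    "r12 m \<le> (\<Sum>l\<in>L. rate P (\<lambda>u. u) (b m l))" "0 \<le> (\<Sum>l\<in>L. balance P (b m l))" for m
    using ob[of m] unfolding outer_bounds_def by - (elim conjE, assumption)+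
  have le: "u \<le> v" if "f \<longlonglongrightarrow> u" "g \<longlonglongrightarrow> v" "\<And>m. f m \<le> g m" for u v :: real and f g
    using LIMSEQ_le[OF that(1,2)] that(3) by blast
  have "outer_bounds P L b' R1 R2 R12"
    unfolding outer_bounds_def
    by (intro conjI allI L b'0 b'1 le[OF rs(1) total(1) bounds(1)] le[OF rs(2) total(1) bounds(2)]
      le[OF rs(3) total(1) bounds(3)] le[OF rs(1) tendsto_sum[OF label(2)] bounds(4)]
      le[OF rs(2) tendsto_sum[OF label(3)] bounds(5)] le[OF rs(3) tendsto_sum[OF label(1)] bounds(6)]
      le[OF tendsto_const tendsto_sum[OF label(4)] bounds(7)])
  then show ?thesis by (intro exI)
qed


section \<open>From achievable pairs to points of the region\<close>

lemma outer_bounds_mono: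
  assumes "outer_bounds P L b r1 r2 r12" "s1 \<le> r1" "s2 \<le> r2" "s12 \<le> r12"
  shows "outer_bounds P L b s1 s2 s12"
  using assms unfolding outer_bounds_def by (meson order.trans)

text \<open>One \<open>\<delta>\<close> bounds both error probabilities and the Fano constants
  divided by \<open>n\<close>. The latter holds from \<open>n = 2 / \<delta>\<close> on, since the
  sum bound loses two bits.\<close>

lemma achievable_outer_bounds:
  fixes P :: "('x1::finite, 'x2::finite, 'y1::finite, 'y2::finite, 'f1::finite, 'f2::finite) icgf"
  assumes P: "\<And>x1 x2 y1 y2 z1 z2. pmf (P x1 x2) (y1, y2, z1, z2) =
      pmf (Q x1 x2) (y1, y2) * pmf (F1 x2) z1 * pmf (F2 x1) z2"
    and ach: "achievable P R1 R2" and \<delta>: "0 < \<delta>" "\<delta> \<le> 1"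
  shows "\<exists>b :: nat \<Rightarrow> 'x1 \<times> 'x2 \<Rightarrow> real. outer_bounds P {..<CARD('x1) * CARD('x2) + 3} b
    ((1 - \<delta>) * R1 - \<delta>) ((1 - \<delta>) * R2 - \<delta>) ((1 - \<delta>) * (R1 + R2) - \<delta>)"
proof -
  have R: "0 \<le> R1" "0 \<le> R2" using ach by (auto simp: achievable_def)
  have "\<forall>\<^sub>F n in sequentially. \<exists>M1 M2 e1 e2 f1 f2 g1 g2. is_code P n M1 M2 e1 e2 f1 f2 g1 g2 \<and>
          R1 \<le> log 2 (real M1) / real n \<and> R2 \<le> log 2 (real M2) / real n \<and> e1 \<le> \<delta> \<and> e2 \<le> \<delta>"
    using ach \<delta>(1) unfolding achievable_def by blast
  moreover have "\<forall>\<^sub>F n in sequentially. 2 / \<delta> \<le> real n \<and> 0 < n"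
    by (intro eventually_conj eventually_gt_at_top)
      (auto intro: eventually_sequentiallyI[of "nat \<lceil>2 / \<delta>\<rceil>"] simp: le_nat_iff nat_le_iff ceiling_le_iff)
  ultimately have "\<forall>\<^sub>F n in sequentially. (\<exists>M1 M2 e1 e2 f1 f2 g1 g2. is_code P n M1 M2 e1 e2 f1 f2 g1 g2 \<and>
          R1 \<le> log 2 (real M1) / real n \<and> R2 \<le> log 2 (real M2) / real n \<and> e1 \<le> \<delta> \<and> e2 \<le> \<delta>)
          \<and> (2 / \<delta> \<le> real n \<and> 0 < n)"
    by (rule eventually_conj)
  then obtain n M1 M2 e1 e2 f1 f2 g1 g2 where code: "is_code P n M1 M2 e1 e2 f1 f2 g1 g2"
    and M: "R1 \<le> log 2 (real M1) / real n" "R2 \<le> log 2 (real M2) / real n"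
    and e: "e1 \<le> \<delta>" "e2 \<le> \<delta>" and n: "2 / \<delta> \<le> real n" "0 < n"
    using eventually_happens'[OF sequentially_bot] by blast
  interpret feedback_code P f1 f2 M1 M2
    using code by unfold_locales (auto simp: is_code_def)
  have rate: "(1 - \<delta>) * R \<le> (1 - e) * log 2 (real M) / real n"
    if "R \<le> log 2 (real M) / real n" "e \<le> \<delta>" "0 \<le> R" for R e and M :: nat
  proof -
    have "(1 - \<delta>) * R \<le> (1 - e) * (log 2 (real M) / real n)"
      using that \<delta> by (intro mult_mono) auto
    then show ?thesis by simp
  qed
  have inv: "2 / real n \<le> \<delta>"
    using n \<delta>(1) by (simp add: field_simps)
  moreover have "1 / real n \<le> 2 / real n" by (simp add: divide_right_mono)
  ultimately have "1 / real n \<le> \<delta>" by linarith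
  then have "(1 - \<delta>) * R1 - \<delta> \<le> ((1 - e1) * log 2 M1 - 1) / n"
    "(1 - \<delta>) * R2 - \<delta> \<le> ((1 - e2) * log 2 M2 - 1) / n"
    "(1 - \<delta>) * (R1 + R2) - \<delta> \<le> ((1 - e1) * log 2 M1 + (1 - e2) * log 2 M2 - 2) / n"
    using rate[OF M(1) e(1) R(1)] rate[OF M(2) e(2) R(2)] inv
    unfolding diff_divide_distrib add_divide_distrib distrib_left by linarith+
  then have "outer_bounds P (SIGMA i:{..<n}. FB ` St i) (\<lambda>(i, t) x. 1 / n * slice i t x)
      ((1 - \<delta>) * R1 - \<delta>) ((1 - \<delta>) * R2 - \<delta>) ((1 - \<delta>) * (R1 + R2) - \<delta>)"
    by (rule outer_bounds_mono[OF code_outer_bounds[OF P code n(2)]])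
  then show ?thesis by (rule outer_bounds_few_labels)
qed

text \<open>The law \<open>J\<close> puts the slice of label \<open>l\<close>, passed through the
  channel, on the outcomes with \<open>T = l\<close>. Informations conditioned on \<open>T\<close>
  then split over the labels, while the unconditioned ones see only the sum of the slices.\<close>

lemma outer_bounds_in_DB_region:
  fixes P :: "('x1::finite, 'x2::finite, 'y1::finite, 'y2::finite, 'f1::finite, 'f2::finite) icgf"
    and b :: "nat \<Rightarrow> 'x1 \<times> 'x2 \<Rightarrow> real"
  assumes P: "\<And>x1 x2 y1 y2 z1 z2. pmf (P x1 x2) (y1, y2, z1, z2) =
      pmf (Q x1 x2) (y1, y2) * pmf (F1 x2) z1 * pmf (F2 x1) z2"
    and ob: "outer_bounds P {..<CARD('x1) * CARD('x2) + 3} b R1 R2 (R1 + R2)"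
    and R: "0 \<le> R1" "0 \<le> R2"
  shows "(R1, R2) \<in> DB_region Q F1 F2"
proof -
  let ?L = "{..<CARD('x1) * CARD('x2) + 3}"
  have b0: "0 \<le> b l x" for l x using ob unfolding outer_bounds_def by blast
  have b1: "(\<Sum>l\<in>?L. \<Sum>x\<in>UNIV. b l x) = 1" using ob unfolding outer_bounds_def by blast
  define DA where "DA = ?L \<times> (UNIV :: ('x1 \<times> 'x2) set)"
  define D where "D = ?L \<times> (UNIV :: ('x1 \<times> 'x2 \<times> 'y1 \<times> 'y2 \<times> 'f1 \<times> 'f2) set)"
  have "\<exists>A. \<forall>v. pmf A v = (\<lambda>(l, x). if l \<in> ?L then b l x else 0) v"
  proof (rule pmf_with_finite_support)
    show "sum (\<lambda>(l, x). if l \<in> ?L then b l x else 0) DA = 1"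
      unfolding DA_def sum.cartesian_product[symmetric] by (rule trans[OF sum.cong[OF refl] b1]) simp
  qed (auto simp: DA_def b0 split: if_splits)
  then obtain A :: "(nat \<times> 'x1 \<times> 'x2) pmf"
    where A: "\<And>l x. pmf A (l, x) = (if l \<in> ?L then b l x else 0)" by auto
  have chan_sum: "(\<Sum>r\<in>UNIV. joint_weight P (b l) r) = (\<Sum>x\<in>UNIV. b l x)" for l
  proof -
    have "(\<Sum>r\<in>UNIV. joint_weight P (b l) r) = (\<Sum>x1\<in>UNIV. \<Sum>x2\<in>UNIV. b l (x1, x2) * (\<Sum>u\<in>UNIV. pmf (P x1 x2) u))"
      unfolding joint_weight_def sum_distrib_left UNIV_Times_UNIV[symmetric] sum.cartesian_product' by simp
    also have "\<dots> = (\<Sum>x1\<in>UNIV. \<Sum>x2\<in>UNIV. b l (x1, x2))"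
      by (simp add: sum_pmf_eq_1)
    also have "\<dots> = (\<Sum>x\<in>UNIV. b l x)"
      unfolding UNIV_Times_UNIV[symmetric] sum.cartesian_product' ..
    finally show ?thesis .
  qed
  have "\<exists>J. \<forall>v. pmf J v = (\<lambda>(l, r). if l \<in> ?L then joint_weight P (b l) r else 0) v"
  proof (rule pmf_with_finite_support)
    show "sum (\<lambda>(l, r). if l \<in> ?L then joint_weight P (b l) r else 0) D = 1"
      unfolding D_def sum.cartesian_product[symmetric] by (rule trans[OF sum.cong[OF refl] b1]) (simp add: chan_sum)
  qed (auto simp: D_def b0 joint_weight_nonneg split: if_splits)
  then obtain J :: "('x1, 'x2, 'y1, 'y2, 'f1, 'f2) outcome pmf"
    where J: "\<And>l r. pmf J (l, r) = (if l \<in> ?L then joint_weight P (b l) r else 0)" by auto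
  have D: "finite D" "set_pmf J \<subseteq> D"
    by (auto simp: D_def set_pmf_iff J split: if_splits)
  \<comment> \<open>The third premise says that the condition contains the label, in whatever
    position of the tuple \<open>T\<close> stands.\<close>
  have labelled: "cmi D (pmf J) X' Y' Z' = (\<Sum>l\<in>?L. cmi UNIV (joint_weight P (b l)) X Y Z)"
    if "\<And>l r. X' (l, r) = X r" "\<And>l r. Y' (l, r) = Y r"
      "\<And>l r l' r'. Z' (l, r) = Z' (l', r') \<longleftrightarrow> l = l' \<and> Z r = Z r'"
    for X' :: "_ \<Rightarrow> 'u" and Y' :: "_ \<Rightarrow> 'v" and Z' :: "_ \<Rightarrow> 'w" and X Y and Z :: "_ \<Rightarrow> 'z"
  proof -
    have "cmi D (pmf J) X' Y' Z' = cmi D (pmf J) (\<lambda>(l, r). X r) (\<lambda>(l, r). Y r) (\<lambda>(l, r). (Z r, l))"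
      by (rule cmi_cong) (auto simp: that)
    also have "\<dots> = (\<Sum>l\<in>?L. cmi UNIV (\<lambda>r. pmf J (l, r)) X Y Z)"
      unfolding D_def by (rule cmi_split) auto
    finally show ?thesis by (simp add: J)
  qed
  have unlabelled: "cmi D (pmf J) X' Y' (\<lambda>_. ()) = cmi UNIV (joint_weight P (\<lambda>x. \<Sum>l\<in>?L. b l x)) X Y (\<lambda>_. ())"
    if "\<And>l r. X' (l, r) = X r" "\<And>l r. Y' (l, r) = Y r"
    for X' :: "_ \<Rightarrow> 'u" and Y' :: "_ \<Rightarrow> 'v" and X Y
  proof -
    have "cmi UNIV (joint_weight P (\<lambda>x. \<Sum>l\<in>?L. b l x)) X Y (\<lambda>_. ()) =
        cmi D (pmf J) (\<lambda>s. X (snd s)) (\<lambda>s. Y (snd s)) (\<lambda>s. ())"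
    proof (rule cmi_push)
      fix v :: "'x1 \<times> 'x2 \<times> 'y1 \<times> 'y2 \<times> 'f1 \<times> 'f2"
      have "{s \<in> D. snd s = v} = (\<lambda>l. (l, v)) ` ?L" by (auto simp: D_def)
      then have "marg D (pmf J) snd v = sum (pmf J) ((\<lambda>l. (l, v)) ` ?L)"
        unfolding marg_def by (simp only:)
      also have "\<dots> = (\<Sum>l\<in>?L. joint_weight P (b l) v)"
        by (subst sum.reindex) (auto simp: inj_on_def J)
      finally show "joint_weight P (\<lambda>x. \<Sum>l\<in>?L. b l x) v = marg D (pmf J) snd v"
        by (simp add: joint_weight_def sum_distrib_right split: prod.splits)
    qed (use D in auto)
    also have "\<dots> = cmi D (pmf J) X' Y' (\<lambda>_. ())"
      by (rule cmi_cong) (auto simp: that split: prod.splits)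
    finally show ?thesis ..
  qed
  note rv = rvT_def rvX1_def rvX2_def rvY1_def rvY2_def rvF1_def rvF2_def
  have MI1: "MI J (\<lambda>s. (rvX1 s, rvX2 s)) rvY1 = rate P (\<lambda>(y1, y2, z1, z2). y1) (\<lambda>x. \<Sum>l\<in>?L. b l x)"
    unfolding MI_eq_cmi[OF D] rate_def by (rule unlabelled) (auto simp: rv split: prod.splits)
  have MI2: "MI J (\<lambda>s. (rvX1 s, rvX2 s)) rvY2 = rate P (\<lambda>(y1, y2, z1, z2). y2) (\<lambda>x. \<Sum>l\<in>?L. b l x)"
    unfolding MI_eq_cmi[OF D] rate_def by (rule unlabelled) (auto simp: rv split: prod.splits)
  have MI12: "MI J (\<lambda>s. (rvX1 s, rvX2 s)) (\<lambda>s. (rvY1 s, rvY2 s)) =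
      rate P (\<lambda>(y1, y2, z1, z2). (y1, y2)) (\<lambda>x. \<Sum>l\<in>?L. b l x)"
    unfolding MI_eq_cmi[OF D] rate_def by (rule unlabelled) (auto simp: rv split: prod.splits)
  have CMI1: "CMI J rvX1 (\<lambda>s. (rvY1 s, rvY2 s, rvF2 s)) (\<lambda>s. (rvX2 s, rvT s)) = (\<Sum>l\<in>?L. info1 P (b l))"
    unfolding CMI_eq_cmi[OF D] info1_def by (rule labelled) (auto simp: rv split: prod.splits)
  have CMI2: "CMI J rvX2 (\<lambda>s. (rvY1 s, rvY2 s, rvF1 s)) (\<lambda>s. (rvX1 s, rvT s)) = (\<Sum>l\<in>?L. info2 P (b l))"
    unfolding CMI_eq_cmi[OF D] info2_def by (rule labelled) (auto simp: rv split: prod.splits)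
  have CMI12: "CMI J (\<lambda>s. (rvX1 s, rvX2 s)) (\<lambda>s. (rvY1 s, rvY2 s, rvF1 s, rvF2 s)) rvT =
      (\<Sum>l\<in>?L. rate P (\<lambda>u. u) (b l))"
    unfolding CMI_eq_cmi[OF D] rate_def by (rule labelled) (auto simp: rv split: prod.splits)
  have "CMI J rvX1 rvX2 (\<lambda>s. (rvF1 s, rvF2 s, rvT s)) - CMI J rvX1 rvX2 rvT = (\<Sum>l\<in>?L. balance P (b l))"
    unfolding CMI_eq_cmi[OF D] balance_def sum_subtractf
    by (rule arg_cong2[of _ _ _ _ "(-)"]; rule labelled) (auto simp: rv split: prod.splits)
  then have DB: "CMI J rvX1 rvX2 rvT \<le> CMI J rvX1 rvX2 (\<lambda>s. (rvF1 s, rvF2 s, rvT s))"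
    using ob unfolding outer_bounds_def by linarith
  have J_prod: "pmf J (t, x1, x2, y1, y2, z1, z2) =
      pmf A (t, x1, x2) * pmf (Q x1 x2) (y1, y2) * pmf (F1 x2) z1 * pmf (F2 x1) z2" for t x1 x2 y1 y2 z1 z2
    by (simp add: J A joint_weight_def P)
  have T: "rvT ` set_pmf J \<subseteq> ?L"
    using D(2) by (auto simp: D_def rvT_def)
  show ?thesis
    unfolding DB_region_def using ob unfolding outer_bounds_def
    by (intro CollectI case_prodI conjI R exI[of _ ?L] exI[of _ A] exI[of _ J] allI J_prod T DB)
      (simp_all only: MI1 MI2 MI12 CMI1 CMI2 CMI12 finite_lessThan card_lessThan order.refl)
qed

theorem theorem5:
  fixes P :: "('x1::finite, 'x2::finite, 'y1::finite, 'y2::finite, 'f1::finite, 'f2::finite) icgf"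
    and Q :: "'x1 \<Rightarrow> 'x2 \<Rightarrow> ('y1 \<times> 'y2) pmf"
    and F1 :: "'x2 \<Rightarrow> 'f1 pmf"
    and F2 :: "'x1 \<Rightarrow> 'f2 pmf"
  assumes "\<And>x1 x2 y1 y2 z1 z2. pmf (P x1 x2) (y1, y2, z1, z2) =
             pmf (Q x1 x2) (y1, y2) * pmf (F1 x2) z1 * pmf (F2 x1) z2"
  shows "capacity_region P \<subseteq> DB_region Q F1 F2"
proof
  fix R assume "R \<in> capacity_region P"
  then obtain r where r: "\<And>m. r m \<in> {(R1, R2). achievable P R1 R2}" "r \<longlonglongrightarrow> R"
    unfolding capacity_region_def closure_sequential by blast
  have ach: "achievable P (fst (r m)) (snd (r m))" for m
    using r(1)[of m] by (simp add: case_prod_unfold)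
  have lim: "(\<lambda>m. fst (r m)) \<longlonglongrightarrow> fst R" "(\<lambda>m. snd (r m)) \<longlonglongrightarrow> snd R"
    using r(2) by (auto intro: tendsto_fst tendsto_snd)
  \<comment> \<open>One limit serves two approximations: the achievable pairs \<open>r m\<close>
    tend to the point \<open>R\<close> of the closure, and the slack allowed to the
    \<open>m\<close>-th pair tends to 0.\<close>
  define \<delta> where "\<delta> m = inverse (real (Suc m))" for m
  have \<delta>: "\<delta> \<longlonglongrightarrow> 0" unfolding \<delta>_def by (rule LIMSEQ_inverse_real_of_nat)
  have \<delta>_pos: "0 < \<delta> m" and \<delta>_le: "\<delta> m \<le> 1" for m
    by (auto simp: \<delta>_def inverse_le_1_iff)
  have "\<forall>m. \<exists>b :: nat \<Rightarrow> 'x1 \<times> 'x2 \<Rightarrow> real. outer_bounds P {..<CARD('x1) * CARD('x2) + 3} b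
      ((1 - \<delta> m) * fst (r m) - \<delta> m) ((1 - \<delta> m) * snd (r m) - \<delta> m)
      ((1 - \<delta> m) * (fst (r m) + snd (r m)) - \<delta> m)"
    using achievable_outer_bounds[OF assms ach \<delta>_pos \<delta>_le] by blast
  from choice[OF this] obtain b :: "nat \<Rightarrow> nat \<Rightarrow> 'x1 \<times> 'x2 \<Rightarrow> real"
    where b: "\<And>m. outer_bounds P {..<CARD('x1) * CARD('x2) + 3} (b m)
      ((1 - \<delta> m) * fst (r m) - \<delta> m) ((1 - \<delta> m) * snd (r m) - \<delta> m)
      ((1 - \<delta> m) * (fst (r m) + snd (r m)) - \<delta> m)"
    by blast
  have "(\<lambda>m. (1 - \<delta> m) * fst (r m) - \<delta> m) \<longlonglongrightarrow> (1 - 0) * fst R - 0"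
    "(\<lambda>m. (1 - \<delta> m) * snd (r m) - \<delta> m) \<longlonglongrightarrow> (1 - 0) * snd R - 0"
    "(\<lambda>m. (1 - \<delta> m) * (fst (r m) + snd (r m)) - \<delta> m) \<longlonglongrightarrow> (1 - 0) * (fst R + snd R) - 0"
    by (intro tendsto_diff tendsto_mult tendsto_add tendsto_const \<delta> lim)+
  from outer_bounds_limit[OF b this]
  obtain b' where "outer_bounds P {..<CARD('x1) * CARD('x2) + 3} b' (fst R) (snd R) (fst R + snd R)"
    by auto
  moreover have "0 \<le> fst R" "0 \<le> snd R"
    using ach by (auto intro!: LIMSEQ_le_const[OF lim(1)] LIMSEQ_le_const[OF lim(2)] simp: achievable_def)
  ultimately show "R \<in> DB_region Q F1 F2"
    using outer_bounds_in_DB_region[where ?R1.0 = "fst R" and ?R2.0 = "snd R", OF assms] by simp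
qed

end
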